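(* Consider the equation $$u_{tt}=u_{xx}+(\cot x)\,u_{x}+\frac{1}{\sin^{2}x}\,u_{yy}+f(u),$$ where $f:\mathbb{R}\to\mathbb{R}$ is a smooth function. For any function $f(u)$, the isometry algebra $Isom(\mathbb{S}^2\times\mathbb{R})$ generates a variational symmetry Lie algebra of this equation. If $f(u)=c\,u$ with $c$ a constant, then the symmetry $$S_\infty=b(x,y,t)\frac{\partial}{\partial u}$$ is a Noether symmetry, where $b=b(x,y,t)$ satisfies $$b_{tt}=b_{xx}+(\cot x)\,b_{x}+\frac{1}{\sin^{2}x}\,b_{yy}+c\,b .$$
   Context: Let $x^0=t$, $x^1=x$, $x^2=y$ be the local coordinates on $\mathbb{S}^2\times\mathbb{R}$, where $t\in\mathbb{R}$ and $(x,y)$ are spherical coordinates on $\mathbb{S}^2$ ($x\in(0,\pi)$ the polar angle, $y$ the azimuthal angle). $\mathbb{S}^2\times\mathbb{R}$ is equipped with the pseudo-Riemannian metric $g$ given by $ds^2=dt^2-dx^2-\sin^2 x\,dy^2$. $Isom(\mathbb{S}^2\times\mathbb{R})$ denotes the Lie algebra of Killing vector fields of $(\mathbb{S}^2\times\mathbb{R},g)$, viewed as vector fields on $(t,x,y,u)$-space with no $\partial/\partial u$ component. Let $F$ satisfy $F'(u)=f(u)$ (with $F(u)=cu^2/2$ when $f(u)=cu$). The equation is the Euler-Lagrange equation of the Lagrangian $$\mathcal{L}=\frac{\sin x}{2}u_t^2-\frac{\sin x}{2}u_x^2-\frac{1}{2\sin x}u_y^2+\sin x\,F(u).$$ For a vector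 field $X=\xi^i\,\partial/\partial x^i+\eta\,\partial/\partial u$ (with coefficients functions of $(t,x,y,u)$), let $X^{(1)}$ be its first prolongation and $D_i$ the total derivative with respect to $x^i$ (summation over repeated indices). $X$ is a variational symmetry if $X^{(1)}\mathcal{L}+\mathcal{L}\,D_i\xi^i=0$. $X$ is a Noether symmetry if $X^{(1)}\mathcal{L}+\mathcal{L}\,D_i\xi^i=Div(V)$ for some $V=(V^0,V^1,V^2)$ depending on $(t,x,y,u)$, where $Div(V)=D_iV^i$. *)

theory Defs
  imports "HOL-Analysis.Analysis"
begin

section \<open>Smooth functions and partial derivatives\<close>

fun iterated_derivative ::
    "'a::euclidean_space list \<Rightarrow> ('a \<Rightarrow> 'b::real_normed_vector) \<Rightarrow> 'a \<Rightarrow> 'b" where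
  "iterated_derivative [] f = f"
| "iterated_derivative (v # vs) f =
     (\<lambda>p. frechet_derivative (iterated_derivative vs f) (at p) v)"

text \<open>Meant for open \<open>S\<close>, where it is the class of \<open>C\<close>-infinity functions.\<close>

definition smooth_on :: "'a::euclidean_space set \<Rightarrow> ('a \<Rightarrow> 'b::real_normed_vector) \<Rightarrow> bool" where
  "smooth_on S f \<longleftrightarrow> (\<forall>vs. \<forall>p\<in>S. iterated_derivative vs f differentiable (at p))"

text \<open>
  A point \<open>p\<close> of type \<open>real ^ 3\<close> has coordinates \<open>p $ 0 = t\<close>, \<open>p $ 1 = x\<close>, \<open>p $ 2 = y\<close>.
  The index type \<open>3\<close> consists of \<open>0\<close>, \<open>1\<close>, \<open>2\<close> (and \<open>3 = 0\<close> in it).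
\<close>

definition partial :: "3 \<Rightarrow> (real ^ 3 \<Rightarrow> real) \<Rightarrow> real ^ 3 \<Rightarrow> real" where
  "partial i f p = frechet_derivative f (at p) (axis i 1)"


section \<open>Spherical coordinates and Killing fields\<close>

text \<open>
  The azimuthal angle \<open>y\<close> ranges over all reals: the chart domain covers
  the product of the line with the sphere without its poles.
\<close>

definition chart_domain :: "(real ^ 3) set" where
  "chart_domain = {p. 0 < p $ 1 \<and> p $ 1 < pi}"

definition sphere_embedding :: "real ^ 3 \<Rightarrow> real \<times> real \<times> real \<times> real" where
  "sphere_embedding p =
     (p $ 0, sin (p $ 1) * cos (p $ 2), sin (p $ 1) * sin (p $ 2), cos (p $ 1))"

definition metric :: "real ^ 3 \<Rightarrow> real ^ 3 ^ 3" where
  "metric p = (\<chi> i j. if i \<noteq> j then 0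
                       else if i = 0 then 1
                       else if i = 1 then - 1
                       else - (sin (p $ 1))\<^sup>2)"

text \<open>The components of the Lie derivative of \<open>g\<close> along \<open>\<xi>\<close>.\<close>

definition lie_derivative_metric ::
    "(real ^ 3 \<Rightarrow> real ^ 3 ^ 3) \<Rightarrow> (real ^ 3 \<Rightarrow> real ^ 3) \<Rightarrow> 3 \<Rightarrow> 3 \<Rightarrow> real ^ 3 \<Rightarrow> real" where
  "lie_derivative_metric g \<xi> i j p =
     (\<Sum>k\<in>UNIV. \<xi> p $ k * partial k (\<lambda>q. g q $ i $ j) p
               + g p $ k $ j * partial i (\<lambda>q. \<xi> q $ k) p
               + g p $ i $ k * partial j (\<lambda>q. \<xi> q $ k) p)"

text \<open>
  \<open>\<xi>\<close> is the coordinate expression of a smooth vector field on the whole manifold, poles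
  included: its push-forward along the embedding is the restriction of a smooth map of the
  ambient space. In particular \<open>\<xi>\<close> is periodic in \<open>y\<close>.
\<close>

definition sphere_vector_field :: "(real ^ 3 \<Rightarrow> real ^ 3) \<Rightarrow> bool" where
  "sphere_vector_field \<xi> \<longleftrightarrow> smooth_on chart_domain \<xi> \<and>
     (\<exists>W. smooth_on UNIV W \<and>
        (\<forall>p\<in>chart_domain. W (sphere_embedding p)
            = frechet_derivative sphere_embedding (at p) (\<xi> p)))"

text \<open>The Killing equation on the chart gives it at the poles by continuity.\<close>

definition killing_field :: "(real ^ 3 \<Rightarrow> real ^ 3) \<Rightarrow> bool" where
  "killing_field \<xi> \<longleftrightarrow> sphere_vector_field \<xi> \<and>
     (\<forall>p\<in>chart_domain. \<forall>i j. lie_derivative_metric metric \<xi> i j p = 0)"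


section \<open>Vector fields on the space of independent and dependent variables\<close>

text \<open>
  A point of the total space is \<open>(p, u)\<close>, one of the first jet space is \<open>((p, u), q)\<close> with
  \<open>q $ i\<close> standing for the first derivative of \<open>u\<close> by the \<open>i\<close>-th coordinate. A vector field \<open>X\<close>
  on the total space has components \<open>fst (X z) $ i\<close> along the \<open>i\<close>-th coordinate and
  \<open>snd (X z)\<close> along \<open>u\<close>.
\<close>

type_synonym total_space = "(real ^ 3) \<times> real"
type_synonym jet_space = "total_space \<times> (real ^ 3)"
type_synonym vector_field = "total_space \<Rightarrow> total_space"

definition lie_bracket :: "vector_field \<Rightarrow> vector_field \<Rightarrow> vector_field" where
  "lie_bracket X Y z =
     frechet_derivative Y (at z) (X z) - frechet_derivative X (at z) (Y z)"

definition lie_algebra_on :: "(real ^ 3) set \<Rightarrow> vector_field set \<Rightarrow> bool" where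
  "lie_algebra_on \<Omega> A \<longleftrightarrow>
     (\<forall>X\<in>A. smooth_on (\<Omega> \<times> UNIV) X) \<and>
     (\<lambda>z. 0) \<in> A \<and>
     (\<forall>X\<in>A. \<forall>Y\<in>A. (\<lambda>z. X z + Y z) \<in> A) \<and>
     (\<forall>a. \<forall>X\<in>A. (\<lambda>z. a *\<^sub>R X z) \<in> A) \<and>
     (\<forall>X\<in>A. \<forall>Y\<in>A. lie_bracket X Y \<in> A)"

text \<open>Only the values over the chart domain matter; values elsewhere are unconstrained.\<close>

definition isom :: "vector_field set" where
  "isom = {X. \<exists>\<xi>. killing_field \<xi> \<and> (\<forall>p\<in>chart_domain. \<forall>u. X (p, u) = (\<xi> p, 0))}"


section \<open>Prolongation, variational symmetries and Noether symmetries\<close>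

definition total_derivative :: "3 \<Rightarrow> (total_space \<Rightarrow> real) \<Rightarrow> jet_space \<Rightarrow> real" where
  "total_derivative i \<phi> = (\<lambda>(z, q).
     frechet_derivative \<phi> (at z) (axis i 1, 0) + q $ i * frechet_derivative \<phi> (at z) (0, 1))"

definition total_divergence :: "(total_space \<Rightarrow> real ^ 3) \<Rightarrow> jet_space \<Rightarrow> real" where
  "total_divergence V w = (\<Sum>i\<in>UNIV. total_derivative i (\<lambda>z. V z $ i) w)"

definition prolongation_coeff :: "vector_field \<Rightarrow> 3 \<Rightarrow> jet_space \<Rightarrow> real" where
  "prolongation_coeff X i w =
     total_derivative i (\<lambda>z. snd (X z)) w
     - (\<Sum>j\<in>UNIV. snd w $ j * total_derivative i (\<lambda>z. fst (X z) $ j) w)"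

definition first_prolongation :: "vector_field \<Rightarrow> (jet_space \<Rightarrow> real) \<Rightarrow> jet_space \<Rightarrow> real" where
  "first_prolongation X L w =
     (\<Sum>i\<in>UNIV. fst (X (fst w)) $ i * frechet_derivative L (at w) ((axis i 1, 0), 0))
     + snd (X (fst w)) * frechet_derivative L (at w) ((0, 1), 0)
     + (\<Sum>i\<in>UNIV. prolongation_coeff X i w * frechet_derivative L (at w) ((0, 0), axis i 1))"

definition variational_symmetry ::
    "(real ^ 3) set \<Rightarrow> (jet_space \<Rightarrow> real) \<Rightarrow> vector_field \<Rightarrow> bool" where
  "variational_symmetry \<Omega> L X \<longleftrightarrow> smooth_on (\<Omega> \<times> UNIV) X \<and>
     (\<forall>w\<in>(\<Omega> \<times> UNIV) \<times> UNIV.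
        first_prolongation X L w + L w * total_divergence (\<lambda>z. fst (X z)) w = 0)"

definition noether_symmetry ::
    "(real ^ 3) set \<Rightarrow> (jet_space \<Rightarrow> real) \<Rightarrow> vector_field \<Rightarrow> bool" where
  "noether_symmetry \<Omega> L X \<longleftrightarrow> smooth_on (\<Omega> \<times> UNIV) X \<and>
     (\<exists>V. smooth_on (\<Omega> \<times> UNIV) V \<and>
        (\<forall>w\<in>(\<Omega> \<times> UNIV) \<times> UNIV.
           first_prolongation X L w + L w * total_divergence (\<lambda>z. fst (X z)) w
             = total_divergence V w))"


section \<open>The wave equation and its Lagrangian\<close>

definition solves_wave_equation ::
    "(real \<Rightarrow> real) \<Rightarrow> (real ^ 3) set \<Rightarrow> (real ^ 3 \<Rightarrow> real) \<Rightarrow> bool" where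
  "solves_wave_equation f \<Omega> u \<longleftrightarrow>
     (\<forall>p\<in>\<Omega>. partial 0 (partial 0 u) p =
        partial 1 (partial 1 u) p + cot (p $ 1) * partial 1 u p
        + 1 / (sin (p $ 1))\<^sup>2 * partial 2 (partial 2 u) p + f (u p))"

definition lagrangian :: "(real \<Rightarrow> real) \<Rightarrow> jet_space \<Rightarrow> real" where
  "lagrangian F = (\<lambda>((p, u), q).
     sin (p $ 1) / 2 * (q $ 0)\<^sup>2 - sin (p $ 1) / 2 * (q $ 1)\<^sup>2
     - 1 / (2 * sin (p $ 1)) * (q $ 2)\<^sup>2 + sin (p $ 1) * F u)"

definition first_jet :: "(real ^ 3 \<Rightarrow> real) \<Rightarrow> real ^ 3 \<Rightarrow> jet_space" where
  "first_jet u p = ((p, u p), \<chi> i. partial i u p)"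

definition euler_lagrange ::
    "(jet_space \<Rightarrow> real) \<Rightarrow> (real ^ 3 \<Rightarrow> real) \<Rightarrow> real ^ 3 \<Rightarrow> real" where
  "euler_lagrange L u p =
     frechet_derivative L (at (first_jet u p)) ((0, 1), 0)
     - (\<Sum>i\<in>UNIV. partial i (\<lambda>p'. frechet_derivative L (at (first_jet u p')) ((0, 0), axis i 1)) p)"

definition S_infinity :: "(real ^ 3 \<Rightarrow> real) \<Rightarrow> vector_field" where
  "S_infinity b = (\<lambda>(p, u). (0, b p))"

lemma lagrangian_has_derivative:
  assumes F: "(F has_real_derivative f u) (at u)" and s: "sin (p $ 1) \<noteq> 0"
  shows "(lagrangian F has_derivative (\<lambda>((dp, du), dq).
      cos (p $ 1) * dp $ 1 * ((q $ 0)\<^sup>2 / 2 - (q $ 1)\<^sup>2 / 2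
         + (q $ 2)\<^sup>2 / (2 * (sin (p $ 1))\<^sup>2) + F u)
      + sin (p $ 1) * f u * du
      + sin (p $ 1) * q $ 0 * dq $ 0 - sin (p $ 1) * q $ 1 * dq $ 1
      - q $ 2 * dq $ 2 / sin (p $ 1))) (at ((p, u), q))"
proof -
  have F': "((\<lambda>w::jet_space. F (snd (fst w))) has_derivative (\<lambda>h. f u * snd (fst h)))
      (at ((p, u), q))"
    by (rule has_derivative_compose[where g = F and f = "\<lambda>w. snd (fst w)", of "\<lambda>h. snd (fst h)"])
      (use F in \<open>auto simp: has_field_derivative_def intro!: derivative_eq_intros\<close>)
  have nth: "((\<lambda>w. g w $ i) has_derivative (\<lambda>h. g' h $ i)) net"
    if "(g has_derivative g') net" for g :: "jet_space \<Rightarrow> real ^ 3" and g' i net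
    using bounded_linear.has_derivative[OF bounded_linear_vec_nth that] .
  have p: "((\<lambda>w::jet_space. fst (fst w) $ i) has_derivative (\<lambda>h. fst (fst h) $ i)) net" for i net
    by (intro nth derivative_intros)
  have q: "((\<lambda>w::jet_space. snd w $ i) has_derivative (\<lambda>h. snd h $ i)) net" for i net
    by (intro nth derivative_intros)
  have sin: "((\<lambda>w::jet_space. sin (fst (fst w) $ 1)) has_derivative
      (\<lambda>h. cos (p $ 1) * fst (fst h) $ 1)) (at ((p, u), q))"
    by (rule has_derivative_eq_rhs[OF has_derivative_sin[OF p]]) (simp add: mult.commute)
  note rules = has_derivative_add has_derivative_diff has_derivative_mult has_derivative_power
    has_derivative_divide has_derivative_const
  show ?thesis
    unfolding lagrangian_def case_prod_beta
    apply (rule has_derivative_eq_rhs)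
     apply (rule F' sin p q rules | use s in \<open>simp; fail\<close>)+
    apply (rule ext)
    using s apply (simp add: divide_simps)
    apply (simp add: algebra_simps power2_eq_square)
    done
qed

lemma partial_eqI:
  assumes "(g has_derivative g') (at p)" "open \<Omega>" "p \<in> \<Omega>" "\<And>p'. p' \<in> \<Omega> \<Longrightarrow> h p' = g p'"
  shows "partial i h p = g' (axis i 1)"
proof -
  have "(h has_derivative g') (at p)"
    using has_derivative_transform_within_open[OF assms(1-3)] assms(4) by simp
  then show ?thesis
    unfolding partial_def by (simp add: frechet_derivative_at[symmetric])
qed

text \<open>The wave equation is the Euler-Lagrange equation of the Lagrangian.\<close>

lemma euler_lagrange_iff_wave_equation:
  assumes \<Omega>: "open \<Omega>" "\<Omega> \<subseteq> chart_domain"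
    and u: "smooth_on \<Omega> u"
    and F: "\<And>s. (F has_real_derivative f s) (at s)"
  shows "(\<forall>p\<in>\<Omega>. euler_lagrange (lagrangian F) u p = 0) \<longleftrightarrow> solves_wave_equation f \<Omega> u"
proof -
  have s: "sin (p $ 1) > 0" if "p \<in> \<Omega>" for p
    using that \<Omega>(2) by (auto simp: chart_domain_def intro: sin_gt_zero)
  have L: "frechet_derivative (lagrangian F) (at (first_jet u p)) = (\<lambda>((dp, du), dq).
      cos (p $ 1) * dp $ 1 * ((partial 0 u p)\<^sup>2 / 2 - (partial 1 u p)\<^sup>2 / 2
         + (partial 2 u p)\<^sup>2 / (2 * (sin (p $ 1))\<^sup>2) + F (u p))
      + sin (p $ 1) * f (u p) * du
      + sin (p $ 1) * partial 0 u p * dq $ 0 - sin (p $ 1) * partial 1 u p * dq $ 1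
      - partial 2 u p * dq $ 2 / sin (p $ 1))" if "p \<in> \<Omega>" for p
    using lagrangian_has_derivative[of F f "u p" p "\<chi> i. partial i u p"] F s[OF that]
    by (simp add: first_jet_def frechet_derivative_at[symmetric])
  have d: "(partial i u has_derivative frechet_derivative (partial i u) (at p)) (at p)"
    if "p \<in> \<Omega>" for i p
  proof -
    have "iterated_derivative [axis i 1] u differentiable (at p)"
      using u that unfolding smooth_on_def by blast
    moreover have "iterated_derivative [axis i 1] u = partial i u"
      by (simp add: fun_eq_iff partial_def)
    ultimately show ?thesis by (simp add: frechet_derivative_works)
  qed
  have x: "((\<lambda>p. p $ 1) has_derivative (\<lambda>h. h $ 1)) net" for net :: "(real ^ 3) filter"
    by (rule bounded_linear.has_derivative[OF bounded_linear_vec_nth has_derivative_ident])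
  have "euler_lagrange (lagrangian F) u p = - sin (p $ 1) *
      (partial 0 (partial 0 u) p - (partial 1 (partial 1 u) p + cot (p $ 1) * partial 1 u p
        + 1 / (sin (p $ 1))\<^sup>2 * partial 2 (partial 2 u) p + f (u p)))" if p: "p \<in> \<Omega>" for p
  proof -
    define E where
      "E i = (\<lambda>p'. frechet_derivative (lagrangian F) (at (first_jet u p')) ((0, 0), axis i 1))" for i
    have E: "E 0 p' = sin (p' $ 1) * partial 0 u p'" "E 1 p' = - (sin (p' $ 1) * partial 1 u p')"
      "E 2 p' = - (partial 2 u p' / sin (p' $ 1))" if "p' \<in> \<Omega>" for p'
      by (simp_all add: E_def L[OF that] axis_def)
    have "partial 0 (E 0) p = sin (p $ 1) * partial 0 (partial 0 u) p"
      by (subst partial_eqI[OF _ \<Omega>(1) p E(1)])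
        (rule derivative_intros x d[OF p] | simp add: partial_def axis_def)+
    moreover have "partial 1 (E 1) p
        = - (sin (p $ 1) * partial 1 (partial 1 u) p + cos (p $ 1) * partial 1 u p)"
      by (subst partial_eqI[OF _ \<Omega>(1) p E(2)])
        (rule derivative_intros x d[OF p] | simp add: partial_def axis_def)+
    moreover have "partial 2 (E 2) p = - (partial 2 (partial 2 u) p / sin (p $ 1))"
      by (subst partial_eqI[OF _ \<Omega>(1) p E(3)])
        (rule derivative_intros x d[OF p] | use s[OF p] in \<open>simp add: partial_def axis_def\<close>)+
    moreover have "(\<Sum>i\<in>UNIV. partial i (E i) p)
        = partial 0 (E 0) p + partial 1 (E 1) p + partial 2 (E 2) p"
    proof -
      have "(3 :: 3) = 0" by simp
      then show ?thesis unfolding sum_3 by (simp only: ac_simps)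
    qed
    ultimately have "(\<Sum>i\<in>UNIV. partial i (E i) p) = sin (p $ 1) * partial 0 (partial 0 u) p
        - (sin (p $ 1) * partial 1 (partial 1 u) p + cos (p $ 1) * partial 1 u p)
        - partial 2 (partial 2 u) p / sin (p $ 1)"
      by simp
    moreover have "euler_lagrange (lagrangian F) u p
        = sin (p $ 1) * f (u p) - (\<Sum>i\<in>UNIV. partial i (E i) p)"
      by (simp add: euler_lagrange_def E_def L[OF p])
    ultimately have "euler_lagrange (lagrangian F) u p = sin (p $ 1) * f (u p)
        - (sin (p $ 1) * partial 0 (partial 0 u) p
           - (sin (p $ 1) * partial 1 (partial 1 u) p + cos (p $ 1) * partial 1 u p)
           - partial 2 (partial 2 u) p / sin (p $ 1))"
      by (simp only:)
    also have "\<dots> = - sin (p $ 1) *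
      (partial 0 (partial 0 u) p - (partial 1 (partial 1 u) p + cot (p $ 1) * partial 1 u p
        + 1 / (sin (p $ 1))\<^sup>2 * partial 2 (partial 2 u) p + f (u p)))"
      using s[OF p] by (simp add: cot_def field_simps power2_eq_square)
    finally show ?thesis .
  qed
  moreover have "- sin (p $ 1) * (a - b) = 0 \<longleftrightarrow> a = b" if "p \<in> \<Omega>" for p a b
    using s[OF that] by simp
  ultimately show ?thesis
    unfolding solves_wave_equation_def by simp
qed

end

theory Submission
  imports Defs
begin

text \<open>
  Write \<open>g\<close> for the metric. Since \<open>sin x\<close> is its volume density and \<open>1, -1, - 1 / sin\<^sup>2 x\<close> are the
  diagonal entries of its inverse, the Lagrangian is the density
  \<open>\<surd>\<bar>det g\<bar> (g\<^sup>i\<^sup>j u\<^sub>i u\<^sub>j / 2 + F u)\<close>. It is built from \<open>g\<close> and functions of \<open>u\<close> only, so a flow that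
  preserves \<open>g\<close> and does not move \<open>u\<close> preserves it, whatever \<open>F\<close> is. Infinitesimally this is an
  algebraic consequence of the six Killing equations (\<open>killing_equations\<close>), carried out in
  \<open>killing_field_variational_symmetry\<close>.

  That the Killing fields are closed under brackets rests on the symmetry of second derivatives
  (\<open>second_derivative_symmetric\<close>), which enters twice. The bracket again annihilates the
  metric because \<open>[\<xi>, \<eta>]\<close> acts on tensors as the commutator of the actions of \<open>\<xi>\<close> and \<open>\<eta>\<close>
  (\<open>metric_lie_derivative_field_bracket\<close>). And it again extends over the poles: if \<open>\<xi>\<close> and \<open>\<eta>\<close> are
  the restrictions of ambient fields \<open>X\<close> and \<open>Y\<close>, the ambient bracket \<open>[X, Y]\<close> restricts to \<open>[\<xi>, \<eta>]\<close>
  (\<open>field_bracket_related\<close>). The smoothness that has to be shown along the way follows from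
  closure of the smooth functions under the operations of calculus.

  In the linear case \<open>F u = c u\<^sup>2 / 2\<close>, translating \<open>u\<close> by \<open>b\<close> changes the Lagrangian to first order by
  the linear expression \<open>b L\<^sub>u + b\<^sub>i L\<^bsub>u\<^sub>i\<^esub>\<close>. The associated bilinear form in \<open>u\<close> and \<open>b\<close> is symmetric, so
  this equals \<open>u L\<^sub>u + u\<^sub>i L\<^bsub>u\<^sub>i\<^esub>\<close> with the derivatives of \<open>L\<close> taken along \<open>b\<close>; as \<open>b\<close> solves the
  Euler-Lagrange equation, it is the divergence of \<open>u\<close> times the momenta of \<open>b\<close>, with components
  \<open>u sin x b\<^sub>t\<close>, \<open>- u sin x b\<^sub>x\<close> and \<open>- u b\<^sub>y / sin x\<close> (\<open>solution_noether_symmetry\<close>).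
\<close>

section \<open>A calculus of smooth functions\<close>

text \<open>
  Being \<open>k\<close> times differentiable, with the first derivative peeled off. Closure properties pass
  from a function to its derivative and so are inductions on \<open>k\<close>, for which \<open>smooth_on\<close> itself,
  quantifying over all orders at once, offers no measure.
\<close>

primrec differentiable_times ::
    "nat \<Rightarrow> 'a::euclidean_space set \<Rightarrow> ('a \<Rightarrow> 'b::real_normed_vector) \<Rightarrow> bool" where
  "differentiable_times 0 S f \<longleftrightarrow> True"
| "differentiable_times (Suc k) S f \<longleftrightarrow>
     (\<forall>p\<in>S. f differentiable (at p)) \<and>
     (\<forall>v. differentiable_times k S (\<lambda>p. frechet_derivative f (at p) v))"

text \<open>The last direction in the list is the one differentiated first.\<close>

lemma iterated_derivative_snoc:
  "iterated_derivative (vs @ [v]) f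
     = iterated_derivative vs (\<lambda>p. frechet_derivative f (at p) v)"
  by (induction vs) auto

lemma differentiable_times_iff_iterated_derivative:
  "differentiable_times k S f \<longleftrightarrow>
     (\<forall>vs. length vs < k \<longrightarrow> (\<forall>p\<in>S. iterated_derivative vs f differentiable (at p)))"
proof (induction k arbitrary: f)
  case (Suc k)
  have "(\<forall>vs. length vs < Suc k \<longrightarrow> (\<forall>p\<in>S. iterated_derivative vs f differentiable (at p)))
      \<longleftrightarrow> (\<forall>p\<in>S. f differentiable (at p)) \<and>
        (\<forall>v vs. length vs < k \<longrightarrow> (\<forall>p\<in>S. iterated_derivative (vs @ [v]) f differentiable (at p)))"
    (is "?L \<longleftrightarrow> ?A \<and> ?R")
  proof
    assume L: ?L
    have ?A using L[rule_format, of "[]"] by auto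
    moreover have ?R using L by (metis length_append_singleton not_less_eq)
    ultimately show "?A \<and> ?R" ..
  next
    assume AR: "?A \<and> ?R"
    have "iterated_derivative vs f differentiable (at p)" if "length vs < Suc k" "p \<in> S" for vs p
    proof (cases vs rule: rev_cases)
      case Nil
      then show ?thesis using AR that by simp
    next
      case (snoc ws v)
      then show ?thesis using AR that by auto
    qed
    then show ?L by blast
  qed
  then show ?case
    using Suc by (simp add: iterated_derivative_snoc)
qed simp

lemma smooth_on_iff_differentiable_times: "smooth_on S f \<longleftrightarrow> (\<forall>k. differentiable_times k S f)"
  unfolding smooth_on_def differentiable_times_iff_iterated_derivative by blast

lemma smooth_on_has_derivative:
  assumes "smooth_on S f" "p \<in> S"
  shows "(f has_derivative frechet_derivative f (at p)) (at p)"
proof -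
  have "f differentiable (at p)"
    using assms unfolding smooth_on_def by (metis iterated_derivative.simps(1))
  then show ?thesis unfolding frechet_derivative_works .
qed

lemma smooth_on_directional_derivative:
  "smooth_on S f \<Longrightarrow> smooth_on S (\<lambda>p. frechet_derivative f (at p) v)"
  unfolding smooth_on_iff_differentiable_times by (metis differentiable_times.simps(2))

lemma smooth_on_subset: "smooth_on S f \<Longrightarrow> T \<subseteq> S \<Longrightarrow> smooth_on T f"
  unfolding smooth_on_def by blast

lemma frechet_derivative_eq_applied:
  "(f has_derivative f') (at p) \<Longrightarrow> frechet_derivative f (at p) v = f' v"
  by (metis frechet_derivative_at)

lemma differentiable_times_Suc_D: "differentiable_times (Suc k) S f \<Longrightarrow> differentiable_times k S f"
  unfolding differentiable_times_iff_iterated_derivative by simp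

text \<open>
  Openness matters here: the value of a derivative at a point of \<open>S\<close> depends on the function
  nearby only, and all nearby points lie in \<open>S\<close>.
\<close>

lemma differentiable_times_cong:
  assumes "open S" "differentiable_times k S f" "\<And>p. p \<in> S \<Longrightarrow> f p = g p"
  shows "differentiable_times k S g"
  using assms(2,3)
proof (induction k arbitrary: f g)
  case (Suc k)
  have g: "(g has_derivative frechet_derivative f (at p)) (at p)" if "p \<in> S" for p
  proof (rule has_derivative_transform_within_open[OF _ assms(1) that Suc.prems(2)])
    show "(f has_derivative frechet_derivative f (at p)) (at p)"
      using Suc.prems(1) that unfolding frechet_derivative_works[symmetric] by simp
  qed
  have "differentiable_times k S (\<lambda>p. frechet_derivative g (at p) v)" for v
  proof (rule Suc.IH)
    show "differentiable_times k S (\<lambda>p. frechet_derivative f (at p) v)"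
      using Suc.prems(1) by simp
    show "frechet_derivative f (at p) v = frechet_derivative g (at p) v" if "p \<in> S" for p
      by (rule frechet_derivative_eq_applied[OF g[OF that], symmetric])
  qed
  with g show ?case unfolding differentiable_times.simps differentiable_def by blast
qed simp

lemma smooth_on_cong:
  "open S \<Longrightarrow> smooth_on S f \<Longrightarrow> (\<And>p. p \<in> S \<Longrightarrow> f p = g p) \<Longrightarrow> smooth_on S g"
  unfolding smooth_on_iff_differentiable_times by (metis differentiable_times_cong)

text \<open>
  This lets a derivative be given by a formula valid on \<open>S\<close> instead of by \<open>frechet_derivative\<close>.
  The inductions on the order below all go through it.
\<close>

lemma differentiable_times_SucI:
  assumes "open S" "\<And>p. p \<in> S \<Longrightarrow> (f has_derivative f' p) (at p)"
    "\<And>v. differentiable_times k S (\<lambda>p. f' p v)"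
  shows "differentiable_times (Suc k) S f"
proof -
  have "differentiable_times k S (\<lambda>p. frechet_derivative f (at p) v)" for v
    by (rule differentiable_times_cong[OF assms(1) assms(3)[of v]])
      (rule frechet_derivative_eq_applied[OF assms(2), symmetric])
  with assms(2) show ?thesis unfolding differentiable_times.simps differentiable_def by blast
qed

lemma differentiable_times_SucD:
  assumes "differentiable_times (Suc k) S f"
  shows "p \<in> S \<Longrightarrow> (f has_derivative frechet_derivative f (at p)) (at p)"
    "differentiable_times k S (\<lambda>p. frechet_derivative f (at p) v)"
  using assms unfolding frechet_derivative_works[symmetric] by simp_all

lemma smooth_on_const: "smooth_on S (\<lambda>p. c)"
proof -
  have "differentiable_times k S (\<lambda>p. c)" for k and c :: 'b
    by (induction k arbitrary: c) auto
  then show ?thesis by (simp add: smooth_on_iff_differentiable_times)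
qed

lemma differentiable_times_add:
  assumes "open S" "differentiable_times k S f" "differentiable_times k S g"
  shows "differentiable_times k S (\<lambda>p. f p + g p)"
  using assms(2,3)
proof (induction k arbitrary: f g)
  case (Suc k)
  note f = differentiable_times_SucD[OF Suc.prems(1)] and g = differentiable_times_SucD[OF Suc.prems(2)]
  show ?case
    by (rule differentiable_times_SucI[OF assms(1) has_derivative_add[OF f(1) g(1)]])
      (use f(2) g(2) in \<open>auto intro!: Suc.IH\<close>)
qed simp

lemma smooth_on_linear_compose:
  assumes "open S" "smooth_on S f" "bounded_linear A"
  shows "smooth_on S (\<lambda>p. A (f p))"
proof -
  have "differentiable_times k S (\<lambda>p. A (f p))" if "differentiable_times k S f" for k
    using that
  proof (induction k arbitrary: f)
    case (Suc k)
    note f = differentiable_times_SucD[OF Suc.prems]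
    show ?case
      by (rule differentiable_times_SucI[OF assms(1) bounded_linear.has_derivative[OF assms(3) f(1)]])
        (use f(2) in \<open>auto intro!: Suc.IH\<close>)
  qed simp
  then show ?thesis using assms(2) by (simp add: smooth_on_iff_differentiable_times)
qed

lemma smooth_on_compose_linear:
  fixes f :: "'a::euclidean_space \<Rightarrow> 'b::real_normed_vector" and B :: "'c::euclidean_space \<Rightarrow> 'a"
  assumes "open T" "smooth_on S f" "bounded_linear B" "\<And>q. q \<in> T \<Longrightarrow> B q \<in> S"
  shows "smooth_on T (\<lambda>q. f (B q))"
proof -
  have "differentiable_times k T (\<lambda>q. f (B q))" if "differentiable_times k S f" for k
    using that
  proof (induction k arbitrary: f)
    case (Suc k)
    note f = differentiable_times_SucD[OF Suc.prems]
    have B: "(B has_derivative B) (at q)" for q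
      using bounded_linear_imp_has_derivative[OF assms(3)] .
    show ?case
      by (rule differentiable_times_SucI[OF assms(1) has_derivative_compose[OF B f(1)]])
        (use f(2) assms(4) in \<open>auto intro!: Suc.IH\<close>)
  qed simp
  then show ?thesis using assms(2) by (simp add: smooth_on_iff_differentiable_times)
qed

lemma smooth_on_linear:
  fixes B :: "'a::euclidean_space \<Rightarrow> 'b::real_normed_vector"
  assumes "open S" "bounded_linear B"
  shows "smooth_on S B"
proof -
  have "differentiable_times k S B" for k
  proof (cases k)
    case (Suc j)
    show ?thesis unfolding Suc
      by (rule differentiable_times_SucI[OF assms(1) bounded_linear_imp_has_derivative[OF assms(2)]])
       (use smooth_on_const in \<open>auto simp: smooth_on_iff_differentiable_times\<close>)
  qed simp
  then show ?thesis by (simp add: smooth_on_iff_differentiable_times)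
qed

text \<open>Leibniz' rule keeps products within reach of an induction on the order: each of the two
  terms of the derivative of a product is a product of functions one order lower.\<close>

lemma differentiable_times_bilinear:
  assumes "open S" "bounded_bilinear mul" "differentiable_times k S f" "differentiable_times k S g"
  shows "differentiable_times k S (\<lambda>p. mul (f p) (g p))"
  using assms(3,4)
proof (induction k arbitrary: f g)
  case (Suc k)
  note f = differentiable_times_SucD[OF Suc.prems(1)] and g = differentiable_times_SucD[OF Suc.prems(2)]
  show ?case
    by (rule differentiable_times_SucI[OF assms(1) bounded_bilinear.FDERIV[OF assms(2) f(1) g(1)]])
      (use f(2) g(2) in \<open>auto intro!: differentiable_times_add[OF assms(1)] Suc.IH
        differentiable_times_Suc_D[OF Suc.prems(1)] differentiable_times_Suc_D[OF Suc.prems(2)]\<close>)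
qed simp

lemma differentiable_times_inverse:
  fixes f :: "'a::euclidean_space \<Rightarrow> real"
  assumes "open S" "differentiable_times k S f" "\<And>p. p \<in> S \<Longrightarrow> f p \<noteq> 0"
  shows "differentiable_times k S (\<lambda>p. inverse (f p))"
  using assms(2)
proof (induction k)
  case (Suc k)
  note f = differentiable_times_SucD[OF Suc.prems(1)]
  note mult = differentiable_times_bilinear[OF assms(1) bounded_bilinear_mult]
  have const: "differentiable_times k S (\<lambda>p. c)" for c :: real
    using smooth_on_const smooth_on_iff_differentiable_times by blast
  show ?case
  proof (rule differentiable_times_SucI[OF assms(1)])
    show "((\<lambda>p. inverse (f p)) has_derivative
        (\<lambda>h. (- 1) * (inverse (f p) * frechet_derivative f (at p) h * inverse (f p)))) (at p)"
      if "p \<in> S" for p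
      using Deriv.has_derivative_inverse[OF assms(3)[OF that] f(1)[OF that]] by simp
    show "differentiable_times k S
        (\<lambda>p. (- 1) * (inverse (f p) * frechet_derivative f (at p) v * inverse (f p)))" for v
      by (intro mult const f(2) Suc.IH differentiable_times_Suc_D[OF Suc.prems])
  qed
qed simp

text \<open>
  Sine and cosine are each other's derivatives up to sign, so neither can be treated without the other.
\<close>

lemma differentiable_times_sin_cos:
  fixes f :: "'a::euclidean_space \<Rightarrow> real"
  assumes "open S" "differentiable_times k S f"
  shows "differentiable_times k S (\<lambda>p. sin (f p)) \<and> differentiable_times k S (\<lambda>p. cos (f p))"
  using assms(2)
proof (induction k)
  case (Suc k)
  note f = differentiable_times_SucD[OF Suc.prems(1)]
  note mult = differentiable_times_bilinear[OF assms(1) bounded_bilinear_mult]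
  have const: "differentiable_times k S (\<lambda>p. c)" for c :: real
    using smooth_on_const smooth_on_iff_differentiable_times by blast
  have IH: "differentiable_times k S (\<lambda>p. sin (f p))" "differentiable_times k S (\<lambda>p. cos (f p))"
    using Suc.IH[OF differentiable_times_Suc_D[OF Suc.prems]] by auto
  have "differentiable_times (Suc k) S (\<lambda>p. sin (f p))"
  proof (rule differentiable_times_SucI[OF assms(1)])
    show "((\<lambda>p. sin (f p)) has_derivative (\<lambda>h. frechet_derivative f (at p) h * cos (f p))) (at p)"
      if "p \<in> S" for p
      using has_derivative_sin[OF f(1)[OF that]] by (simp add: mult.commute)
    show "differentiable_times k S (\<lambda>p. frechet_derivative f (at p) v * cos (f p))" for v
      by (intro mult f(2) IH)
  qed
  moreover have "differentiable_times (Suc k) S (\<lambda>p. cos (f p))"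
  proof (rule differentiable_times_SucI[OF assms(1)])
    show "((\<lambda>p. cos (f p)) has_derivative
        (\<lambda>h. (- 1) * (frechet_derivative f (at p) h * sin (f p)))) (at p)"
      if "p \<in> S" for p
      using has_derivative_cos[OF f(1)[OF that]] by (simp add: mult.commute)
    show "differentiable_times k S (\<lambda>p. (- 1) * (frechet_derivative f (at p) v * sin (f p)))" for v
      by (intro mult const f(2) IH)
  qed
  ultimately show ?case ..
qed simp

lemma smooth_on_add:
  "open S \<Longrightarrow> smooth_on S f \<Longrightarrow> smooth_on S g \<Longrightarrow> smooth_on S (\<lambda>p. f p + g p)"
  by (simp add: smooth_on_iff_differentiable_times differentiable_times_add)

lemma smooth_on_bilinear:
  "open S \<Longrightarrow> bounded_bilinear mul \<Longrightarrow> smooth_on S f \<Longrightarrow> smooth_on S g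
     \<Longrightarrow> smooth_on S (\<lambda>p. mul (f p) (g p))"
  by (simp add: smooth_on_iff_differentiable_times differentiable_times_bilinear)

lemma smooth_on_inverse:
  fixes f :: "'a::euclidean_space \<Rightarrow> real"
  shows "open S \<Longrightarrow> smooth_on S f \<Longrightarrow> (\<And>p. p \<in> S \<Longrightarrow> f p \<noteq> 0) \<Longrightarrow> smooth_on S (\<lambda>p. inverse (f p))"
  by (simp add: smooth_on_iff_differentiable_times differentiable_times_inverse)

lemma smooth_on_sin: "open S \<Longrightarrow> smooth_on S f \<Longrightarrow> smooth_on S (\<lambda>p. sin (f p :: real))"
  and smooth_on_cos: "open S \<Longrightarrow> smooth_on S f \<Longrightarrow> smooth_on S (\<lambda>p. cos (f p :: real))"
  by (simp_all add: smooth_on_iff_differentiable_times differentiable_times_sin_cos)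

lemmas smooth_on_scaleR = smooth_on_bilinear[OF _ bounded_bilinear_scaleR]
lemmas smooth_on_mult = smooth_on_bilinear[OF _ bounded_bilinear_mult]

lemma smooth_on_diff:
  assumes "open S" "smooth_on S f" "smooth_on S g"
  shows "smooth_on S (\<lambda>p. f p - g p)"
proof -
  have "smooth_on S (\<lambda>p. - g p)"
    by (rule smooth_on_linear_compose[OF assms(1,3) bounded_linear_minus[OF bounded_linear_ident]])
  from smooth_on_add[OF assms(1,2) this] show ?thesis by simp
qed

lemma smooth_on_sum:
  assumes "open S" "\<And>i. i \<in> I \<Longrightarrow> smooth_on S (f i)"
  shows "smooth_on S (\<lambda>p. \<Sum>i\<in>I. f i p)"
  using assms(2)
  by (induction I rule: infinite_finite_induct) (auto intro: smooth_on_const smooth_on_add[OF assms(1)])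

lemma smooth_on_Pair:
  assumes "open S" "smooth_on S f" "smooth_on S g"
  shows "smooth_on S (\<lambda>p. (f p, g p))"
proof -
  have "smooth_on S (\<lambda>p. (f p, 0) + (0, g p))"
    by (intro smooth_on_add assms smooth_on_linear_compose[OF assms(1,2)]
        smooth_on_linear_compose[OF assms(1,3)])
      (intro bounded_linear_Pair bounded_linear_ident bounded_linear_zero)+
  then show ?thesis by simp
qed

section \<open>Second derivatives\<close>

text \<open>
  Expansion in a basis turns a derivative in a varying direction into a sum of products, to
  which the Leibniz rule applies.
\<close>

lemma frechet_derivative_expand:
  assumes "smooth_on S f" "p \<in> S"
  shows "frechet_derivative f (at p) v = (\<Sum>b\<in>Basis. (v \<bullet> b) *\<^sub>R frechet_derivative f (at p) b)"
proof -
  interpret D: bounded_linear "frechet_derivative f (at p)"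
    using smooth_on_has_derivative[OF assms] has_derivative_bounded_linear by blast
  have "frechet_derivative f (at p) v = frechet_derivative f (at p) (\<Sum>b\<in>Basis. (v \<bullet> b) *\<^sub>R b)"
    by (simp add: euclidean_representation)
  also have "\<dots> = (\<Sum>b\<in>Basis. (v \<bullet> b) *\<^sub>R frechet_derivative f (at p) b)"
    by (simp add: D.sum D.scaleR)
  finally show ?thesis .
qed

text \<open>
  The function is differentiated along the fixed direction \<open>v\<close> first and along \<open>u\<close> afterwards.
\<close>

definition second_derivative ::
    "('a::euclidean_space \<Rightarrow> 'b::real_normed_vector) \<Rightarrow> 'a \<Rightarrow> 'a \<Rightarrow> 'a \<Rightarrow> 'b" where
  "second_derivative f p u v
     = frechet_derivative (\<lambda>q. frechet_derivative f (at q) v) (at p) u"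

lemma has_derivative_directional_derivative:
  "smooth_on S f \<Longrightarrow> p \<in> S \<Longrightarrow>
    ((\<lambda>q. frechet_derivative f (at q) v) has_derivative (\<lambda>u. second_derivative f p u v)) (at p)"
  unfolding second_derivative_def
  using smooth_on_has_derivative[OF smooth_on_directional_derivative] by blast

text \<open>
  The direction of differentiation varies with the point, whence the second term. Brackets, the
  Killing equation and the relation between fields along a map all contain such derivatives.
\<close>

lemma has_derivative_derivative_along_field:
  fixes f :: "'a::euclidean_space \<Rightarrow> 'b::real_normed_vector"
  assumes S: "open S" "p \<in> S" and f: "smooth_on S f" and \<xi>: "(\<xi> has_derivative \<xi>') (at p)"
  shows "((\<lambda>q. frechet_derivative f (at q) (\<xi> q)) has_derivative
     (\<lambda>h. second_derivative f p h (\<xi> p) + frechet_derivative f (at p) (\<xi>' h))) (at p)"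
proof -
  let ?D = "\<lambda>q. frechet_derivative f (at q)"
  note D2 = has_derivative_directional_derivative[OF f S(2)]
  have expand: "second_derivative f p h v = (\<Sum>b\<in>Basis. (v \<bullet> b) *\<^sub>R second_derivative f p h b)" for h v
  proof -
    have "((\<lambda>q. \<Sum>b\<in>Basis. (v \<bullet> b) *\<^sub>R ?D q b) has_derivative
        (\<lambda>h. \<Sum>b\<in>Basis. (v \<bullet> b) *\<^sub>R second_derivative f p h b)) (at p)"
      by (intro has_derivative_sum has_derivative_scaleR_right D2)
    then have "((\<lambda>q. ?D q v) has_derivative
        (\<lambda>h. \<Sum>b\<in>Basis. (v \<bullet> b) *\<^sub>R second_derivative f p h b)) (at p)"
      by (rule has_derivative_transform_within_open[OF _ S])
        (simp add: frechet_derivative_expand[OF f, of _ v])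
    from has_derivative_unique[OF this D2] show ?thesis by metis
  qed
  have "((\<lambda>q. \<Sum>b\<in>Basis. (\<xi> q \<bullet> b) *\<^sub>R ?D q b) has_derivative
      (\<lambda>h. \<Sum>b\<in>Basis. (\<xi> p \<bullet> b) *\<^sub>R second_derivative f p h b + (\<xi>' h \<bullet> b) *\<^sub>R ?D p b)) (at p)"
    by (intro has_derivative_sum has_derivative_scaleR D2 has_derivative_inner_left \<xi>)
  then have "((\<lambda>q. ?D q (\<xi> q)) has_derivative
      (\<lambda>h. \<Sum>b\<in>Basis. (\<xi> p \<bullet> b) *\<^sub>R second_derivative f p h b + (\<xi>' h \<bullet> b) *\<^sub>R ?D p b)) (at p)"
    by (rule has_derivative_transform_within_open[OF _ S])
      (simp add: frechet_derivative_expand[OF f, of _ "\<xi> _"])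
  then show ?thesis
    by (rule has_derivative_eq_rhs)
      (simp add: fun_eq_iff sum.distrib expand[of _ "\<xi> p"]
        frechet_derivative_expand[OF f S(2), of "\<xi>' _"])
qed

lemma smooth_on_derivative_along_field:
  assumes "open S" "smooth_on S f" "smooth_on S \<xi>"
  shows "smooth_on S (\<lambda>p. frechet_derivative f (at p) (\<xi> p))"
proof -
  have "smooth_on S (\<lambda>p. \<Sum>b\<in>Basis. (\<xi> p \<bullet> b) *\<^sub>R frechet_derivative f (at p) b)"
    by (intro smooth_on_sum smooth_on_scaleR assms(1) smooth_on_directional_derivative assms(2)
        smooth_on_linear_compose[OF assms(1,3)] bounded_linear_inner_left)
  then show ?thesis
    by (rule smooth_on_cong[OF assms(1)])
      (simp add: frechet_derivative_expand[OF assms(2), of _ "\<xi> _"])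
qed

text \<open>The mean value theorem, used once in each direction, turns a second difference into the
  mixed derivative at an intermediate point. The second difference is symmetric in the two
  directions, whence the symmetry of the second derivative in the limit.\<close>

lemma second_difference_eq_mixed_derivative:
  fixes f :: "'a::euclidean_space \<Rightarrow> real"
  assumes f: "smooth_on S f" and h: "h > 0"
    and S: "\<And>s t. 0 \<le> s \<Longrightarrow> s \<le> h \<Longrightarrow> 0 \<le> t \<Longrightarrow> t \<le> h \<Longrightarrow> p + s *\<^sub>R u + t *\<^sub>R v \<in> S"
  obtains s t where "0 \<le> s" "s \<le> h" "0 \<le> t" "t \<le> h"
    "f (p + h *\<^sub>R u + h *\<^sub>R v) - f (p + h *\<^sub>R u) - f (p + h *\<^sub>R v) + f p
       = h\<^sup>2 * second_derivative f (p + s *\<^sub>R u + t *\<^sub>R v) v u"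
proof -
  let ?D = "\<lambda>z. frechet_derivative f (at z)"
  \<comment> \<open>The second difference is the increment of \<open>g\<close>, a first difference along \<open>v\<close>.\<close>
  define g where "g s = f (p + s *\<^sub>R u + h *\<^sub>R v) - f (p + s *\<^sub>R u)" for s
  have line: "((\<lambda>s. q + s *\<^sub>R w) has_derivative (\<lambda>ds. ds *\<^sub>R w)) (at s)" for q w :: 'a and s :: real
    by (auto intro!: derivative_eq_intros)
  have along: "((\<lambda>s. F (q + s *\<^sub>R w)) has_real_derivative frechet_derivative F (at (q + s *\<^sub>R w)) w) (at s)"
    if "smooth_on S F" "q + s *\<^sub>R w \<in> S" for F :: "'a \<Rightarrow> real" and q w s
  proof -
    have "((\<lambda>s. F (q + s *\<^sub>R w)) has_derivative
        (\<lambda>ds. frechet_derivative F (at (q + s *\<^sub>R w)) (ds *\<^sub>R w))) (at s)"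
      by (rule has_derivative_compose[OF line smooth_on_has_derivative[OF that]])
    moreover have "frechet_derivative F (at (q + s *\<^sub>R w)) (ds *\<^sub>R w)
        = frechet_derivative F (at (q + s *\<^sub>R w)) w * ds" for ds
      using smooth_on_has_derivative[OF that] has_derivative_bounded_linear
        bounded_linear.linear linear_cmul by fastforce
    ultimately show ?thesis by (simp add: has_field_derivative_def)
  qed
  have "\<exists>s>0. s < h \<and> g h - g 0 = (h - 0) * (?D (p + s *\<^sub>R u + h *\<^sub>R v) u - ?D (p + s *\<^sub>R u) u)"
  proof (rule MVT2[OF h])
    fix s assume s: "0 \<le> s" "s \<le> h"
    have *: "p + h *\<^sub>R v + s *\<^sub>R u \<in> S" "p + s *\<^sub>R u \<in> S"
      using S[OF s, of h] S[OF s, of 0] h by (auto simp: algebra_simps)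
    show "(g has_real_derivative ?D (p + s *\<^sub>R u + h *\<^sub>R v) u - ?D (p + s *\<^sub>R u) u) (at s)"
      using DERIV_diff[OF along[OF f *(1)] along[OF f *(2)]]
      by (simp add: g_def[abs_def] algebra_simps)
  qed
  then obtain s where s: "0 < s" "s < h"
    "g h - g 0 = h * (?D (p + s *\<^sub>R u + h *\<^sub>R v) u - ?D (p + s *\<^sub>R u) u)" by auto
  have "\<exists>t>0. t < h \<and> ?D (p + s *\<^sub>R u + h *\<^sub>R v) u - ?D (p + s *\<^sub>R u + 0 *\<^sub>R v) u
      = (h - 0) * second_derivative f (p + s *\<^sub>R u + t *\<^sub>R v) v u"
    unfolding second_derivative_def
    by (rule MVT2[OF h]) (use s in \<open>auto intro!: along smooth_on_directional_derivative f S\<close>)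
  then obtain t where "0 < t" "t < h" "?D (p + s *\<^sub>R u + h *\<^sub>R v) u - ?D (p + s *\<^sub>R u) u
      = h * second_derivative f (p + s *\<^sub>R u + t *\<^sub>R v) v u" by auto
  with s that[of s t] show ?thesis
    by (simp add: g_def power2_eq_square)
qed

lemma second_derivative_real_symmetric:
  fixes f :: "'a::euclidean_space \<Rightarrow> real"
  assumes S: "open S" "p \<in> S" and f: "smooth_on S f"
  shows "second_derivative f p u v = second_derivative f p v u"
proof -
  have close: "\<exists>h>0. \<forall>s t. 0 \<le> s \<longrightarrow> s \<le> h \<longrightarrow> 0 \<le> t \<longrightarrow> t \<le> h \<longrightarrow> Q (p + s *\<^sub>R a + t *\<^sub>R b)"
    if Q: "\<forall>\<^sub>F z in nhds p. Q z" for Q and a b :: 'a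
  proof -
    from Q obtain d where d: "d > 0" "\<And>z. dist z p < d \<Longrightarrow> Q z"
      unfolding eventually_nhds_metric by blast
    \<comment> \<open>With the summand 1 the quotient is defined for \<open>a = b = 0\<close> and the bound below is strict.\<close>
    define h where "h = d / (1 + norm a + norm b)"
    have pos: "1 + norm a + norm b > 0" using norm_ge_zero[of a] norm_ge_zero[of b] by linarith
    then have h: "h > 0" using d(1) by (simp add: h_def)
    have "h * (1 + norm a + norm b) = d" using pos by (simp add: h_def)
    then have "h + h * norm a + h * norm b = d" by (simp add: distrib_left)
    have "Q (p + s *\<^sub>R a + t *\<^sub>R b)" if st: "0 \<le> s" "s \<le> h" "0 \<le> t" "t \<le> h" for s t
    proof -
      have "norm (s *\<^sub>R a + t *\<^sub>R b) \<le> s * norm a + t * norm b"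
        using norm_triangle_ineq[of "s *\<^sub>R a" "t *\<^sub>R b"] st by simp
      also have "\<dots> \<le> h * norm a + h * norm b"
        by (intro add_mono mult_right_mono) (use st in auto)
      finally have "norm (s *\<^sub>R a + t *\<^sub>R b) < d" using h \<open>h + h * norm a + h * norm b = d\<close> by linarith
      then show ?thesis by (intro d(2)) (simp add: dist_norm algebra_simps)
    qed
    with h show ?thesis by blast
  qed
  have cont: "\<forall>\<^sub>F z in nhds p. \<bar>second_derivative f z a b - second_derivative f p a b\<bar> < e"
    if "e > 0" for a b and e :: real
  proof -
    have "isCont (\<lambda>z. second_derivative f z a b) p"
      using smooth_on_has_derivative[OF smooth_on_directional_derivative[OF
            smooth_on_directional_derivative[OF f]] S(2), of b a]
      unfolding second_derivative_def by (rule has_derivative_continuous)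
    then have "((\<lambda>z. second_derivative f z a b) \<longlongrightarrow> second_derivative f p a b) (nhds p)"
      by (simp add: isCont_def tendsto_nhds_iff)
    from tendstoD[OF this that] show ?thesis by (simp add: dist_real_def)
  qed
  have "\<bar>second_derivative f p u v - second_derivative f p v u\<bar> \<le> 0 + e" if "e > 0" for e
  proof -
    have e: "e / 2 > 0" using that by simp
    have "\<forall>\<^sub>F z in nhds p. z \<in> S" using S by (rule eventually_nhds_in_open)
    with cont[OF e, of v u] cont[OF e, of u v]
    have "\<forall>\<^sub>F z in nhds p. z \<in> S
        \<and> \<bar>second_derivative f z v u - second_derivative f p v u\<bar> < e / 2
        \<and> \<bar>second_derivative f z u v - second_derivative f p u v\<bar> < e / 2"
      by eventually_elim simp
    from close[OF this, of u v] obtain h where h: "h > 0" and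
      near_conj: "\<And>s t. 0 \<le> s \<Longrightarrow> s \<le> h \<Longrightarrow> 0 \<le> t \<Longrightarrow> t \<le> h \<Longrightarrow>
        p + s *\<^sub>R u + t *\<^sub>R v \<in> S
        \<and> \<bar>second_derivative f (p + s *\<^sub>R u + t *\<^sub>R v) v u - second_derivative f p v u\<bar> < e / 2
        \<and> \<bar>second_derivative f (p + s *\<^sub>R u + t *\<^sub>R v) u v - second_derivative f p u v\<bar> < e / 2"
      by blast
    have near: "z \<in> S" "\<bar>second_derivative f z v u - second_derivative f p v u\<bar> < e / 2"
        "\<bar>second_derivative f z u v - second_derivative f p u v\<bar> < e / 2"
      if "0 \<le> s" "s \<le> h" "0 \<le> t" "t \<le> h" "z = p + s *\<^sub>R u + t *\<^sub>R v" for s t z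
      using near_conj[OF that(1-4)] that(5) by simp_all
    \<comment> \<open>The parallelogram spanned by \<open>v\<close> and \<open>u\<close> is the one spanned by \<open>u\<close> and \<open>v\<close>, so
      the same step \<open>h\<close> serves both orders.\<close>
    have swap: "p + s *\<^sub>R v + t *\<^sub>R u = p + t *\<^sub>R u + s *\<^sub>R v" for s t :: real
      by simp
    have inS: "p + s *\<^sub>R u + t *\<^sub>R v \<in> S" "p + s *\<^sub>R v + t *\<^sub>R u \<in> S"
      if "0 \<le> s" "s \<le> h" "0 \<le> t" "t \<le> h" for s t
      using near(1)[OF that refl] near(1)[OF that(3,4,1,2) swap] .
    obtain s t where st: "0 \<le> s" "s \<le> h" "0 \<le> t" "t \<le> h"
      "f (p + h *\<^sub>R u + h *\<^sub>R v) - f (p + h *\<^sub>R u) - f (p + h *\<^sub>R v) + f p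
         = h\<^sup>2 * second_derivative f (p + s *\<^sub>R u + t *\<^sub>R v) v u"
      by (rule second_difference_eq_mixed_derivative[OF f h inS(1)])
    obtain s' t' where st': "0 \<le> s'" "s' \<le> h" "0 \<le> t'" "t' \<le> h"
      "f (p + h *\<^sub>R v + h *\<^sub>R u) - f (p + h *\<^sub>R v) - f (p + h *\<^sub>R u) + f p
         = h\<^sup>2 * second_derivative f (p + s' *\<^sub>R v + t' *\<^sub>R u) u v"
      by (rule second_difference_eq_mixed_derivative[OF f h inS(2)])
    from st(5) st'(5) have "h\<^sup>2 * second_derivative f (p + s *\<^sub>R u + t *\<^sub>R v) v u
        = h\<^sup>2 * second_derivative f (p + s' *\<^sub>R v + t' *\<^sub>R u) u v"
      unfolding swap[of h h] by linarith
    then have "second_derivative f (p + s *\<^sub>R u + t *\<^sub>R v) v u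
        = second_derivative f (p + s' *\<^sub>R v + t' *\<^sub>R u) u v" using h by simp
    moreover have "\<bar>second_derivative f (p + s *\<^sub>R u + t *\<^sub>R v) v u - second_derivative f p v u\<bar> < e / 2"
      using near(2)[OF st(1-4) refl] .
    moreover have "\<bar>second_derivative f (p + s' *\<^sub>R v + t' *\<^sub>R u) u v - second_derivative f p u v\<bar> < e / 2"
      using near(3)[OF st'(3,4,1,2) swap] .
    ultimately show ?thesis by linarith
  qed
  then have "\<bar>second_derivative f p u v - second_derivative f p v u\<bar> \<le> 0" by (rule field_le_epsilon)
  then show ?thesis by simp
qed

text \<open>
  The real case applies to the scalar products with fixed vectors, which commute with derivatives.
\<close>

lemma second_derivative_symmetric:
  fixes f :: "'a::euclidean_space \<Rightarrow> 'b::euclidean_space"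
  assumes S: "open S" "p \<in> S" and f: "smooth_on S f"
  shows "second_derivative f p u v = second_derivative f p v u"
proof (rule euclidean_eqI)
  fix w :: 'b
  have "second_derivative f p a b \<bullet> w = second_derivative (\<lambda>q. f q \<bullet> w) p a b" for a b
  proof -
    have D: "frechet_derivative (\<lambda>q. f q \<bullet> w) (at q) b = frechet_derivative f (at q) b \<bullet> w"
      if "q \<in> S" for q
      by (rule frechet_derivative_eq_applied[OF
            has_derivative_inner_left[OF smooth_on_has_derivative[OF f that]]])
    have "((\<lambda>q. frechet_derivative f (at q) b \<bullet> w) has_derivative
        (\<lambda>a. second_derivative f p a b \<bullet> w)) (at p)"
      by (intro has_derivative_inner_left has_derivative_directional_derivative[OF f S(2)])
    then have "((\<lambda>q. frechet_derivative (\<lambda>q. f q \<bullet> w) (at q) b) has_derivative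
        (\<lambda>a. second_derivative f p a b \<bullet> w)) (at p)"
      by (rule has_derivative_transform_within_open[OF _ S]) (simp add: D)
    then show ?thesis
      unfolding second_derivative_def[of "\<lambda>q. f q \<bullet> w"]
      by (rule frechet_derivative_eq_applied[symmetric])
  qed
  moreover have "smooth_on S (\<lambda>q. f q \<bullet> w)"
    by (rule smooth_on_linear_compose[OF S(1) f bounded_linear_inner_left])
  ultimately show "second_derivative f p u v \<bullet> w = second_derivative f p v u \<bullet> w"
    using second_derivative_real_symmetric[OF S] by metis
qed

section \<open>Brackets of vector fields\<close>

text \<open>
  The sign is that of \<open>lie_bracket\<close>, of which this is the analogue on an arbitrary Euclidean space.
\<close>

definition field_bracket ::
    "('a::euclidean_space \<Rightarrow> 'a) \<Rightarrow> ('a \<Rightarrow> 'a) \<Rightarrow> 'a \<Rightarrow> 'a" where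
  "field_bracket \<xi> \<eta> p
     = frechet_derivative \<eta> (at p) (\<xi> p) - frechet_derivative \<xi> (at p) (\<eta> p)"

lemma smooth_on_field_bracket:
  "open S \<Longrightarrow> smooth_on S \<xi> \<Longrightarrow> smooth_on S \<eta> \<Longrightarrow> smooth_on S (field_bracket \<xi> \<eta>)"
  unfolding field_bracket_def by (intro smooth_on_diff smooth_on_derivative_along_field)

lemma has_derivative_field_bracket:
  assumes "open S" "p \<in> S" "smooth_on S \<xi>" "smooth_on S \<eta>"
  shows "(field_bracket \<xi> \<eta> has_derivative (\<lambda>v.
     second_derivative \<eta> p v (\<xi> p)
       + frechet_derivative \<eta> (at p) (frechet_derivative \<xi> (at p) v)
     - (second_derivative \<xi> p v (\<eta> p)
       + frechet_derivative \<xi> (at p) (frechet_derivative \<eta> (at p) v)))) (at p)"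
  unfolding field_bracket_def[abs_def]
  by (rule has_derivative_diff[OF
        has_derivative_derivative_along_field[OF assms(1,2,4) smooth_on_has_derivative[OF assms(3,2)]]
        has_derivative_derivative_along_field[OF assms(1,2,3) smooth_on_has_derivative[OF assms(4,2)]]])

text \<open>Differentiating the relation between \<open>\<eta>\<close> and \<open>Y\<close> along \<open>\<xi>\<close> produces the second derivative
  of \<open>\<Phi>\<close> applied to \<open>\<xi>\<close> and \<open>\<eta>\<close>, which is symmetric and so cancels in the bracket.\<close>

lemma field_bracket_related:
  fixes \<Phi> :: "'a::euclidean_space \<Rightarrow> 'b::euclidean_space"
  assumes S: "open S" "p \<in> S" and smooth: "smooth_on S \<Phi>" "smooth_on S \<xi>" "smooth_on S \<eta>"
    and T: "smooth_on T X" "smooth_on T Y" "\<Phi> p \<in> T"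
    and X: "\<And>q. q \<in> S \<Longrightarrow> X (\<Phi> q) = frechet_derivative \<Phi> (at q) (\<xi> q)"
    and Y: "\<And>q. q \<in> S \<Longrightarrow> Y (\<Phi> q) = frechet_derivative \<Phi> (at q) (\<eta> q)"
  shows "field_bracket X Y (\<Phi> p) = frechet_derivative \<Phi> (at p) (field_bracket \<xi> \<eta> p)"
proof -
  have chain: "frechet_derivative Z (at (\<Phi> p)) (frechet_derivative \<Phi> (at p) v)
      = second_derivative \<Phi> p v (\<zeta> p) + frechet_derivative \<Phi> (at p) (frechet_derivative \<zeta> (at p) v)"
    if Z: "smooth_on T Z" and \<zeta>: "smooth_on S \<zeta>"
      and rel: "\<And>q. q \<in> S \<Longrightarrow> Z (\<Phi> q) = frechet_derivative \<Phi> (at q) (\<zeta> q)" for Z \<zeta> v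
  proof -
    have via_\<zeta>: "((\<lambda>q. Z (\<Phi> q)) has_derivative (\<lambda>v. second_derivative \<Phi> p v (\<zeta> p)
        + frechet_derivative \<Phi> (at p) (frechet_derivative \<zeta> (at p) v))) (at p)"
      by (rule has_derivative_transform_within_open[OF has_derivative_derivative_along_field[OF
              S smooth(1) smooth_on_has_derivative[OF \<zeta> S(2)]] S]) (simp add: rel)
    have via_Z: "((\<lambda>q. Z (\<Phi> q)) has_derivative
        (\<lambda>v. frechet_derivative Z (at (\<Phi> p)) (frechet_derivative \<Phi> (at p) v))) (at p)"
      by (rule has_derivative_compose[OF smooth_on_has_derivative[OF smooth(1) S(2)]
            smooth_on_has_derivative[OF Z T(3)]])
    show ?thesis by (rule fun_cong[OF has_derivative_unique[OF via_Z via_\<zeta>]])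
  qed
  have "linear (frechet_derivative \<Phi> (at p))"
    using smooth_on_has_derivative[OF smooth(1) S(2)] has_derivative_linear by blast
  then show ?thesis
    using second_derivative_symmetric[OF S smooth(1), of "\<xi> p" "\<eta> p"]
    by (simp add: field_bracket_def X[OF S(2)] Y[OF S(2)] chain[OF T(2) smooth(3) Y]
        chain[OF T(1) smooth(2) X] linear_diff)
qed

section \<open>Killing fields form a Lie algebra\<close>

text \<open>
  The Lie derivative as a bilinear form in arbitrary vectors \<open>v\<close>, \<open>w\<close>. The proof for brackets inserts
  the vectors \<open>D\<eta> v\<close> and \<open>D\<xi> w\<close> into the Killing equation, which is awkward with components.
\<close>

definition metric_lie_derivative ::
    "(real ^ 'n \<Rightarrow> real ^ 'n ^ 'n) \<Rightarrow> (real ^ 'n \<Rightarrow> real ^ 'n) \<Rightarrow> real ^ 'n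
      \<Rightarrow> real ^ 'n \<Rightarrow> real ^ 'n \<Rightarrow> real" where
  "metric_lie_derivative g \<xi> p v w =
     v \<bullet> (frechet_derivative g (at p) (\<xi> p) *v w)
     + frechet_derivative \<xi> (at p) v \<bullet> (g p *v w)
     + v \<bullet> (g p *v frechet_derivative \<xi> (at p) w)"

lemma bounded_bilinear_matrix_vector_mult:
  "bounded_bilinear ((*v) :: real ^ 'n ^ 'm \<Rightarrow> real ^ 'n \<Rightarrow> real ^ 'm)"
  unfolding bilinear_conv_bounded_bilinear[symmetric] bilinear_def
  by (auto intro!: linearI simp: matrix_vector_mult_add_rdistrib matrix_vector_right_distrib
      matrix_vector_mult_scaleR scaleR_matrix_vector_assoc)

lemmas has_derivative_matrix_vector_mult = bounded_bilinear.FDERIV[OF bounded_bilinear_matrix_vector_mult]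

text \<open>This is \<open>L\<^bsub>[\<xi>,\<eta>]\<^esub> g = L\<^bsub>\<xi>\<^esub> (L\<^bsub>\<eta>\<^esub> g) - L\<^bsub>\<eta>\<^esub> (L\<^bsub>\<xi>\<^esub> g)\<close>
  for fields that annihilate \<open>g\<close>: the derivative of \<open>L\<^bsub>\<eta>\<^esub> g = 0\<close> along \<open>\<xi>\<close>, minus the same with
  \<open>\<xi>\<close> and \<open>\<eta>\<close> exchanged, differs from \<open>L\<^bsub>[\<xi>,\<eta>]\<^esub> g = 0\<close> by instances of the two equations
  themselves, since all second derivatives are symmetric.\<close>

lemma metric_lie_derivative_field_bracket:
  fixes g :: "real ^ 'n \<Rightarrow> real ^ 'n ^ 'n"
  assumes S: "open S" "p \<in> S"
    and smooth: "smooth_on S g" "smooth_on S \<xi>" "smooth_on S \<eta>"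
    and \<xi>: "\<And>q v w. q \<in> S \<Longrightarrow> metric_lie_derivative g \<xi> q v w = 0"
    and \<eta>: "\<And>q v w. q \<in> S \<Longrightarrow> metric_lie_derivative g \<eta> q v w = 0"
  shows "metric_lie_derivative g (field_bracket \<xi> \<eta>) p v w = 0"
proof -
  \<comment> \<open>The derivative of the Killing equation for \<open>\<zeta>\<close> in the direction \<open>h\<close>.\<close>
  have prolonged: "v \<bullet> ((second_derivative g p h (\<zeta> p)
        + frechet_derivative g (at p) (frechet_derivative \<zeta> (at p) h)) *v w)
      + (second_derivative \<zeta> p h v \<bullet> (g p *v w)
        + frechet_derivative \<zeta> (at p) v \<bullet> (frechet_derivative g (at p) h *v w))
      + (v \<bullet> (g p *v second_derivative \<zeta> p h w)
        + v \<bullet> (frechet_derivative g (at p) h *v frechet_derivative \<zeta> (at p) w)) = 0"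
    (is "?P h = 0")
    if \<zeta>: "smooth_on S \<zeta>" and eq: "\<And>q v w. q \<in> S \<Longrightarrow> metric_lie_derivative g \<zeta> q v w = 0"
    for \<zeta> h
  proof -
    have Dg: "((\<lambda>q. frechet_derivative g (at q) (\<zeta> q)) has_derivative
        (\<lambda>h. second_derivative g p h (\<zeta> p)
          + frechet_derivative g (at p) (frechet_derivative \<zeta> (at p) h))) (at p)"
      by (rule has_derivative_derivative_along_field[OF S smooth(1)
            smooth_on_has_derivative[OF \<zeta> S(2)]])
    note rules = has_derivative_add has_derivative_inner has_derivative_matrix_vector_mult
      has_derivative_const Dg has_derivative_directional_derivative[OF \<zeta> S(2)]
      smooth_on_has_derivative[OF smooth(1) S(2)]
    have P: "((\<lambda>q. metric_lie_derivative g \<zeta> q v w) has_derivative ?P) (at p)"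
      unfolding metric_lie_derivative_def
      by (rule has_derivative_eq_rhs, (rule rules)+)
        (simp add: fun_eq_iff matrix_vector_right_distrib inner_add_right)
    have zero: "((\<lambda>q. metric_lie_derivative g \<zeta> q v w) has_derivative (\<lambda>h. 0)) (at p)"
      by (rule has_derivative_transform_within_open[OF has_derivative_const S]) (simp add: eq)
    show ?thesis by (rule fun_cong[OF has_derivative_unique[OF P zero]])
  qed
  have "linear (frechet_derivative g (at p))"
    using smooth_on_has_derivative[OF smooth(1) S(2)] has_derivative_linear by blast
  then have Dg_diff: "frechet_derivative g (at p) (a - b)
      = frechet_derivative g (at p) a - frechet_derivative g (at p) b" for a b
    by (rule linear_diff)
  note sym = second_derivative_symmetric[OF S smooth(1), of "\<eta> p" "\<xi> p"]
    second_derivative_symmetric[OF S smooth(2), of "\<eta> p"]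
    second_derivative_symmetric[OF S smooth(3), of "\<xi> p"]
  have D: "frechet_derivative (field_bracket \<xi> \<eta>) (at p) v
      = second_derivative \<eta> p v (\<xi> p)
       + frechet_derivative \<eta> (at p) (frechet_derivative \<xi> (at p) v)
     - (second_derivative \<xi> p v (\<eta> p)
       + frechet_derivative \<xi> (at p) (frechet_derivative \<eta> (at p) v))" for v
    by (rule frechet_derivative_eq_applied[OF has_derivative_field_bracket[OF S smooth(2,3)]])
  note K = \<xi>[OF S(2), unfolded metric_lie_derivative_def] \<eta>[OF S(2), unfolded metric_lie_derivative_def]
  note distrib = inner_add_left inner_add_right inner_diff_left inner_diff_right
    matrix_vector_right_distrib matrix_vector_mult_add_rdistrib
    matrix_vector_mult_diff_distrib matrix_vector_mult_diff_rdistrib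
  \<comment> \<open>The Killing equations are inserted at the pairs \<open>(D\<eta> v, w)\<close>, \<open>(v, D\<eta> w)\<close> and
    \<open>(D\<xi> v, w)\<close>, \<open>(v, D\<xi> w)\<close>: they replace the first derivatives of \<open>g\<close> by products of first
    derivatives of \<open>\<xi>\<close> and \<open>\<eta>\<close>, which are the ones in the derivative of the bracket.\<close>
  show ?thesis
    using prolonged[OF smooth(3) \<eta>, of "\<xi> p"] prolonged[OF smooth(2) \<xi>, of "\<eta> p"]
      K(1)[of "frechet_derivative \<eta> (at p) v" w] K(1)[of v "frechet_derivative \<eta> (at p) w"]
      K(2)[of "frechet_derivative \<xi> (at p) v" w] K(2)[of v "frechet_derivative \<xi> (at p) w"]
    unfolding metric_lie_derivative_def D
    unfolding field_bracket_def Dg_diff sym distrib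
    by linarith
qed

lemma metric_lie_derivative_linear:
  fixes g :: "real ^ 'n \<Rightarrow> real ^ 'n ^ 'n"
  assumes "p \<in> S" "smooth_on S g" "smooth_on S \<xi>" "smooth_on S \<eta>"
  shows "metric_lie_derivative g (\<lambda>q. \<xi> q + a *\<^sub>R \<eta> q) p v w
    = metric_lie_derivative g \<xi> p v w + a * metric_lie_derivative g \<eta> p v w"
proof -
  have "linear (frechet_derivative g (at p))"
    using smooth_on_has_derivative[OF assms(2,1)] has_derivative_linear by blast
  then have Dg: "frechet_derivative g (at p) (x + a *\<^sub>R y)
      = frechet_derivative g (at p) x + a *\<^sub>R frechet_derivative g (at p) y" for x y
    by (simp add: linear_add linear_cmul)
  have "frechet_derivative (\<lambda>q. \<xi> q + a *\<^sub>R \<eta> q) (at p) x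
      = frechet_derivative \<xi> (at p) x + a *\<^sub>R frechet_derivative \<eta> (at p) x" for x
    by (rule frechet_derivative_eq_applied[OF has_derivative_add[OF
            smooth_on_has_derivative[OF assms(3,1)]
            has_derivative_scaleR_right[OF smooth_on_has_derivative[OF assms(4,1)]]]])
  then show ?thesis
    by (simp add: metric_lie_derivative_def Dg inner_add_left inner_add_right
        matrix_vector_right_distrib matrix_vector_mult_add_rdistrib
        matrix_vector_mult_scaleR scaleR_matrix_vector_assoc[symmetric] distrib_left)
qed

lemma metric_lie_derivative_eq_0I:
  fixes g :: "real ^ 'n \<Rightarrow> real ^ 'n ^ 'n"
  assumes \<xi>: "\<xi> differentiable (at p)"
    and axes: "\<And>i j. metric_lie_derivative g \<xi> p (axis i 1) (axis j 1) = 0"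
  shows "metric_lie_derivative g \<xi> p v w = 0"
proof -
  have lin: "linear (frechet_derivative \<xi> (at p))"
    using linear_frechet_derivative[OF \<xi>] .
  have "bilinear (metric_lie_derivative g \<xi> p)"
    unfolding bilinear_def metric_lie_derivative_def
    by (auto intro!: linearI simp: linear_add[OF lin] linear_cmul[OF lin] inner_add_left
        inner_add_right matrix_vector_right_distrib matrix_vector_mult_scaleR distrib_left)
  moreover have "bilinear (\<lambda>v w :: real ^ 'n. 0 :: real)"
    by (simp add: bilinear_def linear_zero)
  ultimately have "metric_lie_derivative g \<xi> p = (\<lambda>v w. 0)"
    by (rule bilinear_eq_stdbasis) (auto simp: Basis_vec_def axes)
  then show ?thesis by simp
qed

lemma lie_derivative_metric_eq_metric_lie_derivative:
  assumes \<xi>: "\<xi> differentiable (at p)" and g: "g differentiable (at p)"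
  shows "lie_derivative_metric g \<xi> i j p = metric_lie_derivative g \<xi> p (axis i 1) (axis j 1)"
proof -
  note D\<xi> = \<xi>[unfolded frechet_derivative_works] and Dg = g[unfolded frechet_derivative_works]
  have nth: "((\<lambda>q. h q $ i) has_derivative (\<lambda>x. h' x $ i)) net"
    if "(h has_derivative h') net" for h :: "real ^ 3 \<Rightarrow> 'b::euclidean_space ^ 3" and h' i net
    by (rule bounded_linear.has_derivative[OF bounded_linear_vec_nth that])
  have partial_\<xi>: "partial k (\<lambda>q. \<xi> q $ l) p = frechet_derivative \<xi> (at p) (axis k 1) $ l" for k l
    unfolding partial_def by (rule frechet_derivative_eq_applied[OF nth[OF D\<xi>]])
  have partial_g: "partial k (\<lambda>q. g q $ i $ j) p
      = frechet_derivative g (at p) (axis k 1) $ i $ j" for k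
    unfolding partial_def by (rule frechet_derivative_eq_applied[OF nth[OF nth[OF Dg]]])
  have "frechet_derivative g (at p) (\<xi> p)
      = frechet_derivative g (at p) (\<Sum>k\<in>UNIV. \<xi> p $ k *\<^sub>R axis k 1)"
    by (simp add: basis_expansion[of "\<xi> p", unfolded scalar_mult_eq_scaleR])
  also have "\<dots> = (\<Sum>k\<in>UNIV. \<xi> p $ k *\<^sub>R frechet_derivative g (at p) (axis k 1))"
    using linear_frechet_derivative[OF g] by (simp add: linear_sum linear_cmul)
  finally have "frechet_derivative g (at p) (\<xi> p) $ i $ j
      = (\<Sum>k\<in>UNIV. \<xi> p $ k * partial k (\<lambda>q. g q $ i $ j) p)"
    by (simp add: partial_g)
  moreover have "axis i 1 \<bullet> (M *v axis j 1) = M $ i $ j" for M :: "real ^ 3 ^ 3"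
    by (simp add: inner_axis' matrix_vector_mult_basis column_def)
  moreover have "x \<bullet> (M *v axis j 1) = (\<Sum>k\<in>UNIV. M $ k $ j * x $ k)"
    for M :: "real ^ 3 ^ 3" and x
    by (simp add: matrix_vector_mult_basis column_def inner_vec_def mult.commute)
  moreover have "axis i 1 \<bullet> (M *v x) = (\<Sum>k\<in>UNIV. M $ i $ k * x $ k)"
    for M :: "real ^ 3 ^ 3" and x
    by (simp add: inner_axis' matrix_vector_mult_def)
  ultimately show ?thesis
    unfolding lie_derivative_metric_def metric_lie_derivative_def
    by (simp only: partial_\<xi> sum.distrib)
qed

section \<open>The isometry algebra of the sphere times the line\<close>

lemma sum_coordinates: "(\<Sum>i\<in>UNIV. a (i :: 3)) = a 0 + a 1 + (a 2 :: 'a::comm_monoid_add)"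
proof -
  have "(3 :: 3) = 0" by simp
  then show ?thesis unfolding sum_3 by (simp only: ac_simps)
qed

lemma open_chart_domain: "open chart_domain"
  unfolding chart_domain_def
  by (intro open_Collect_conj open_Collect_less continuous_intros)

lemma sin_pos_chart: "p \<in> chart_domain \<Longrightarrow> sin (p $ 1) > 0"
  by (auto simp: chart_domain_def intro: sin_gt_zero)

lemma smooth_on_coordinate: "open S \<Longrightarrow> smooth_on S (\<lambda>p. p $ i :: real)"
  by (rule smooth_on_linear[OF _ bounded_linear_vec_nth])

lemma smooth_on_metric: "smooth_on UNIV metric"
proof -
  let ?E = "\<lambda>k. (\<chi> i j. if i = k \<and> j = k then 1 else 0) :: real ^ 3 ^ 3"
  have "metric p = (?E 0 - ?E 1) + (sin (p $ 1) * sin (p $ 1)) *\<^sub>R (- ?E 2)" for p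
    unfolding vec_eq_iff metric_def by (auto simp: forall_3 power2_eq_square)
  then have "metric = (\<lambda>p. (?E 0 - ?E 1) + (sin (p $ 1) * sin (p $ 1)) *\<^sub>R (- ?E 2))" by auto
  moreover have "smooth_on UNIV (\<lambda>p :: real ^ 3. (?E 0 - ?E 1) + (sin (p $ 1) * sin (p $ 1)) *\<^sub>R (- ?E 2))"
    by (intro smooth_on_add smooth_on_const smooth_on_scaleR smooth_on_mult smooth_on_sin
        smooth_on_coordinate open_UNIV)
  ultimately show ?thesis by (simp only:)
qed

lemma smooth_on_sphere_embedding: "smooth_on UNIV sphere_embedding"
  unfolding sphere_embedding_def[abs_def]
  by (intro smooth_on_Pair smooth_on_mult smooth_on_sin smooth_on_cos smooth_on_coordinate open_UNIV)

lemma killing_field_iff: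
  "killing_field \<xi> \<longleftrightarrow> sphere_vector_field \<xi> \<and>
     (\<forall>p\<in>chart_domain. \<forall>v w. metric_lie_derivative metric \<xi> p v w = 0)"
proof -
  have "(\<forall>i j. lie_derivative_metric metric \<xi> i j p = 0)
      \<longleftrightarrow> (\<forall>v w. metric_lie_derivative metric \<xi> p v w = 0)"
    if "smooth_on chart_domain \<xi>" "p \<in> chart_domain" for p
  proof -
    have d: "\<xi> differentiable (at p)" "metric differentiable (at p)"
      using smooth_on_has_derivative[OF that] smooth_on_has_derivative[OF smooth_on_metric UNIV_I]
      by (auto simp: differentiable_def)
    then show ?thesis
      unfolding lie_derivative_metric_eq_metric_lie_derivative[OF d]
      using metric_lie_derivative_eq_0I[OF d(1)] by blast
  qed
  then show ?thesis
    unfolding killing_field_def sphere_vector_field_def by blast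
qed

lemma killing_field_smooth: "killing_field \<xi> \<Longrightarrow> smooth_on chart_domain \<xi>"
  by (simp add: killing_field_def sphere_vector_field_def)

lemma smooth_metric_chart: "smooth_on chart_domain metric"
  using smooth_on_subset[OF smooth_on_metric] by simp

lemma smooth_embedding_chart: "smooth_on chart_domain sphere_embedding"
  using smooth_on_subset[OF smooth_on_sphere_embedding] by simp

lemma killing_field_combination:
  assumes \<xi>: "killing_field \<xi>" and \<eta>: "killing_field \<eta>"
  shows "killing_field (\<lambda>p. \<xi> p + a *\<^sub>R \<eta> p)"
proof -
  obtain X where X: "smooth_on UNIV X"
    "\<And>p. p \<in> chart_domain \<Longrightarrow> X (sphere_embedding p) = frechet_derivative sphere_embedding (at p) (\<xi> p)"
    using \<xi> unfolding killing_field_def sphere_vector_field_def by blast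
  obtain Y where Y: "smooth_on UNIV Y"
    "\<And>p. p \<in> chart_domain \<Longrightarrow> Y (sphere_embedding p) = frechet_derivative sphere_embedding (at p) (\<eta> p)"
    using \<eta> unfolding killing_field_def sphere_vector_field_def by blast
  have "smooth_on UNIV (\<lambda>z. X z + a *\<^sub>R Y z)" "smooth_on chart_domain (\<lambda>p. \<xi> p + a *\<^sub>R \<eta> p)"
    by (intro smooth_on_add smooth_on_scaleR smooth_on_const X Y killing_field_smooth \<xi> \<eta>
        open_UNIV open_chart_domain)+
  moreover have "X (sphere_embedding p) + a *\<^sub>R Y (sphere_embedding p)
      = frechet_derivative sphere_embedding (at p) (\<xi> p + a *\<^sub>R \<eta> p)" if "p \<in> chart_domain" for p
  proof -
    have "linear (frechet_derivative sphere_embedding (at p))"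
      using smooth_on_has_derivative[OF smooth_on_sphere_embedding UNIV_I] has_derivative_linear
      by blast
    then show ?thesis by (simp add: X Y that linear_add linear_cmul)
  qed
  ultimately have "sphere_vector_field (\<lambda>p. \<xi> p + a *\<^sub>R \<eta> p)"
    unfolding sphere_vector_field_def by (intro conjI exI[of _ "\<lambda>z. X z + a *\<^sub>R Y z"]) auto
  then show ?thesis
    using \<xi> \<eta> unfolding killing_field_iff
    by (simp add: metric_lie_derivative_linear[OF _ smooth_metric_chart
          killing_field_smooth[OF \<xi>] killing_field_smooth[OF \<eta>]])
qed

lemma killing_field_zero: "killing_field (\<lambda>p. 0)"
proof -
  have "linear (frechet_derivative f (at p))" if "smooth_on UNIV f"
    for f :: "'a::euclidean_space \<Rightarrow> 'b::real_normed_vector" and p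
    using smooth_on_has_derivative[OF that UNIV_I] has_derivative_linear by blast
  from this[OF smooth_on_sphere_embedding] this[OF smooth_on_metric] show ?thesis
    unfolding killing_field_iff sphere_vector_field_def metric_lie_derivative_def
    by (auto simp: linear_0 intro!: smooth_on_const exI[of _ "\<lambda>_. 0"])
qed

text \<open>
  The extension over the poles is the bracket of the ambient extensions, since these are related to the
  chart fields along the embedding.
\<close>

lemma killing_field_bracket:
  assumes \<xi>: "killing_field \<xi>" and \<eta>: "killing_field \<eta>"
  shows "killing_field (field_bracket \<xi> \<eta>)"
proof -
  note smooth = killing_field_smooth[OF \<xi>] killing_field_smooth[OF \<eta>]
  obtain X where X: "smooth_on UNIV X"
    "\<And>p. p \<in> chart_domain \<Longrightarrow> X (sphere_embedding p) = frechet_derivative sphere_embedding (at p) (\<xi> p)"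
    using \<xi> unfolding killing_field_def sphere_vector_field_def by blast
  obtain Y where Y: "smooth_on UNIV Y"
    "\<And>p. p \<in> chart_domain \<Longrightarrow> Y (sphere_embedding p) = frechet_derivative sphere_embedding (at p) (\<eta> p)"
    using \<eta> unfolding killing_field_def sphere_vector_field_def by blast
  have "field_bracket X Y (sphere_embedding p)
      = frechet_derivative sphere_embedding (at p) (field_bracket \<xi> \<eta> p)" if "p \<in> chart_domain" for p
    by (rule field_bracket_related[OF open_chart_domain that smooth_embedding_chart smooth X(1) Y(1)
          UNIV_I X(2) Y(2)])
  then have "sphere_vector_field (field_bracket \<xi> \<eta>)"
    unfolding sphere_vector_field_def
    by (intro conjI exI[of _ "field_bracket X Y"])
      (auto intro: smooth_on_field_bracket open_chart_domain smooth X(1) Y(1))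
  moreover have "metric_lie_derivative metric (field_bracket \<xi> \<eta>) p v w = 0"
    if "p \<in> chart_domain" for p v w
    by (rule metric_lie_derivative_field_bracket[OF open_chart_domain that smooth_metric_chart smooth])
      (use \<xi> \<eta> in \<open>auto simp: killing_field_iff\<close>)
  ultimately show ?thesis by (simp add: killing_field_iff)
qed

lemma smooth_on_fibre_constant:
  fixes X :: "(real ^ 3) \<times> real \<Rightarrow> 'b::real_normed_vector"
  assumes "open \<Omega>" "smooth_on \<Omega> G" "\<And>p u. p \<in> \<Omega> \<Longrightarrow> X (p, u) = G p"
  shows "smooth_on (\<Omega> \<times> UNIV) X"
proof (rule smooth_on_cong)
  show "open (\<Omega> \<times> (UNIV :: real set))" using assms(1) by (simp add: open_Times)
  then show "smooth_on (\<Omega> \<times> UNIV) (\<lambda>z :: total_space. G (fst z))"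
    by (intro smooth_on_compose_linear[OF _ assms(2) bounded_linear_fst]) auto
qed (use assms(3) in auto)

text \<open>
  The fields at hand depend on \<open>(p, u)\<close> through \<open>p\<close> alone, and do so only above \<open>\<Omega>\<close>, which is
  enough because \<open>\<Omega>\<close> is open.
\<close>

lemma frechet_derivative_fibre_constant:
  fixes X :: "(real ^ 3) \<times> real \<Rightarrow> 'b::real_normed_vector"
  assumes "open \<Omega>" "p \<in> \<Omega>" "(G has_derivative G') (at p)" "\<And>p u. p \<in> \<Omega> \<Longrightarrow> X (p, u) = G p"
  shows "frechet_derivative X (at (p, u)) h = G' (fst h)"
proof (rule frechet_derivative_eq_applied)
  have "((\<lambda>z. G (fst z)) has_derivative (\<lambda>h. G' (fst h))) (at (p, u))"
    by (rule has_derivative_compose[OF has_derivative_fst[OF has_derivative_ident]])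
      (use assms(3) in simp)
  then show "(X has_derivative (\<lambda>h. G' (fst h))) (at (p, u))"
    by (rule has_derivative_transform_within_open[where s = "\<Omega> \<times> UNIV"])
      (use assms(1,2,4) in \<open>auto simp: open_Times\<close>)
qed

lemma isom_lie_bracket:
  assumes "X \<in> isom" "Y \<in> isom"
  shows "lie_bracket X Y \<in> isom"
proof -
  obtain \<xi> where \<xi>: "killing_field \<xi>" "\<And>p u. p \<in> chart_domain \<Longrightarrow> X (p, u) = (\<xi> p, 0)"
    using assms(1) by (auto simp: isom_def)
  obtain \<eta> where \<eta>: "killing_field \<eta>" "\<And>p u. p \<in> chart_domain \<Longrightarrow> Y (p, u) = (\<eta> p, 0)"
    using assms(2) by (auto simp: isom_def)
  have D: "frechet_derivative Z (at (p, u)) h = (frechet_derivative \<zeta> (at p) (fst h), 0)"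
    if "killing_field \<zeta>" "\<And>p u. p \<in> chart_domain \<Longrightarrow> Z (p, u) = (\<zeta> p, 0)" "p \<in> chart_domain"
    for \<zeta> and Z :: vector_field and p u h
  proof -
    have "((\<lambda>p. (\<zeta> p, 0 :: real)) has_derivative
        (\<lambda>v. (frechet_derivative \<zeta> (at p) v, 0))) (at p)"
      by (rule has_derivative_Pair[OF
            smooth_on_has_derivative[OF killing_field_smooth[OF that(1)] that(3)]
            has_derivative_const])
    from frechet_derivative_fibre_constant[OF open_chart_domain that(3) this that(2)]
    show ?thesis by simp
  qed
  have "lie_bracket X Y (p, u) = (field_bracket \<xi> \<eta> p, 0)" if "p \<in> chart_domain" for p u
    by (simp add: lie_bracket_def field_bracket_def D[OF \<xi> that] D[OF \<eta> that] \<xi>(2)[OF that]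
        \<eta>(2)[OF that])
  then show ?thesis
    unfolding isom_def using killing_field_bracket[OF \<xi>(1) \<eta>(1)] by blast
qed

lemma isom_combination:
  assumes "X \<in> isom" "Y \<in> isom"
  shows "(\<lambda>z. X z + a *\<^sub>R Y z) \<in> isom"
proof -
  from assms obtain \<xi> \<eta> where "killing_field \<xi>" "killing_field \<eta>"
    and X: "\<And>p u. p \<in> chart_domain \<Longrightarrow> X (p, u) = (\<xi> p, 0)"
    and Y: "\<And>p u. p \<in> chart_domain \<Longrightarrow> Y (p, u) = (\<eta> p, 0)"
    by (auto simp: isom_def)
  then have "killing_field (\<lambda>p. \<xi> p + a *\<^sub>R \<eta> p)" by (intro killing_field_combination)
  then show ?thesis
    unfolding isom_def mem_Collect_eq
    by (intro exI[of _ "\<lambda>p. \<xi> p + a *\<^sub>R \<eta> p"] conjI) (simp_all add: X Y)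
qed

lemma isom_smooth:
  assumes "X \<in> isom"
  shows "smooth_on (chart_domain \<times> UNIV) X"
proof -
  from assms obtain \<xi> where \<xi>: "killing_field \<xi>"
    and X: "\<And>p u. p \<in> chart_domain \<Longrightarrow> X (p, u) = (\<xi> p, 0)"
    by (auto simp: isom_def)
  have "smooth_on chart_domain (\<lambda>p. (\<xi> p, 0 :: real))"
    by (intro smooth_on_Pair open_chart_domain killing_field_smooth \<xi> smooth_on_const)
  from open_chart_domain this X show ?thesis by (rule smooth_on_fibre_constant)
qed

lemma isom_lie_algebra: "lie_algebra_on chart_domain isom"
proof -
  have zero: "(\<lambda>z. 0) \<in> isom"
    unfolding isom_def zero_prod_def using killing_field_zero by blast
  show ?thesis
    unfolding lie_algebra_on_def
    using zero isom_smooth isom_lie_bracket isom_combination[where a = 1] isom_combination[OF zero]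
    by simp
qed

section \<open>Prolonged fields acting on the Lagrangian\<close>

lemma total_derivative_fibre_constant:
  assumes "open \<Omega>" "p \<in> \<Omega>" "h differentiable (at p)" "\<And>p u. p \<in> \<Omega> \<Longrightarrow> \<phi> (p, u) = h p"
  shows "total_derivative i \<phi> ((p, u), q) = partial i h p"
proof -
  have D: "(h has_derivative frechet_derivative h (at p)) (at p)"
    using assms(3) unfolding frechet_derivative_works .
  then have "linear (frechet_derivative h (at p))" by (rule has_derivative_linear)
  then show ?thesis
    by (simp add: total_derivative_def partial_def linear_0
        frechet_derivative_fibre_constant[OF assms(1,2) D assms(4)])
qed

text \<open>
  Here \<open>X = \<xi> + b \<partial>/\<partial>u\<close> has coefficients that do not depend on \<open>u\<close>, so total derivatives
  reduce to partial ones. Both kinds of symmetry are instances: \<open>b = 0\<close> for isometries and \<open>\<xi> = 0\<close>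
  for the translations of \<open>u\<close> by a solution.
\<close>

lemma first_prolongation_lagrangian:
  fixes q :: "real ^ 3"
  assumes \<Omega>: "open \<Omega>" "p \<in> \<Omega>" "\<Omega> \<subseteq> chart_domain"
    and F: "(F has_real_derivative f u) (at u)"
    and \<xi>: "\<xi> differentiable (at p)" and b: "b differentiable (at p)"
    and X: "\<And>p u. p \<in> \<Omega> \<Longrightarrow> X (p, u) = (\<xi> p, b p)"
  defines "\<pi> \<equiv> \<lambda>i. partial i b p - (\<Sum>j\<in>UNIV. q $ j * partial i (\<lambda>p. \<xi> p $ j) p)"
  shows "first_prolongation X (lagrangian F) ((p, u), q)
      + lagrangian F ((p, u), q) * total_divergence (\<lambda>z. fst (X z)) ((p, u), q)
    = cos (p $ 1) * \<xi> p $ 1 * ((q $ 0)\<^sup>2 / 2 - (q $ 1)\<^sup>2 / 2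
         + (q $ 2)\<^sup>2 / (2 * (sin (p $ 1))\<^sup>2) + F u)
      + sin (p $ 1) * f u * b p
      + sin (p $ 1) * q $ 0 * \<pi> 0 - sin (p $ 1) * q $ 1 * \<pi> 1 - q $ 2 * \<pi> 2 / sin (p $ 1)
      + lagrangian F ((p, u), q) * (\<Sum>i\<in>UNIV. partial i (\<lambda>p. \<xi> p $ i) p)"
proof -
  have s: "sin (p $ 1) \<noteq> 0" using sin_pos_chart \<Omega>(2,3) by fastforce
  have \<xi>_nth: "(\<lambda>p. \<xi> p $ j) differentiable (at p)" for j
    using bounded_linear.has_derivative[OF bounded_linear_vec_nth] \<xi> unfolding differentiable_def by blast
  have D\<xi>: "total_derivative i (\<lambda>z. fst (X z) $ j) ((p, u), q) = partial i (\<lambda>p. \<xi> p $ j) p" for i j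
    by (rule total_derivative_fibre_constant[OF \<Omega>(1,2) \<xi>_nth]) (simp add: X)
  have Db: "total_derivative i (\<lambda>z. snd (X z)) ((p, u), q) = partial i b p" for i
    by (rule total_derivative_fibre_constant[OF \<Omega>(1,2) b]) (simp add: X)
  have coeff: "prolongation_coeff X i ((p, u), q) = \<pi> i" for i
    by (simp add: prolongation_coeff_def D\<xi> Db \<pi>_def)
  show ?thesis
    unfolding first_prolongation_def total_divergence_def D\<xi> coeff sum_coordinates
      frechet_derivative_eq_applied[OF lagrangian_has_derivative[of F f u, OF F s]]
    by (simp add: X[OF \<Omega>(2)] axis_def algebra_simps)
qed

text \<open>The equations \<open>L\<^bsub>\<xi>\<^esub> g = 0\<close> for the index pairs \<open>00\<close>, \<open>11\<close>, \<open>22\<close>, \<open>01\<close>, \<open>02\<close>, \<open>12\<close>, in this order,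
  solved for one derivative each. In \<open>d i j\<close> the component \<open>\<xi>\<^sup>j\<close> is differentiated along the \<open>i\<close>-th
  coordinate.\<close>

lemma killing_equations:
  assumes "killing_field \<xi>" "p \<in> chart_domain"
  defines "d \<equiv> \<lambda>i j. partial i (\<lambda>p. \<xi> p $ j) p"
  shows "d 0 0 = 0" "d 1 1 = 0" "sin (p $ 1) * d 2 2 = - (cos (p $ 1) * \<xi> p $ 1)"
    "d 1 0 = d 0 1" "d 2 0 = (sin (p $ 1))\<^sup>2 * d 0 2" "d 2 1 = - ((sin (p $ 1))\<^sup>2 * d 1 2)"
proof -
  have const: "partial k (\<lambda>q. c) p = 0" for k c by (simp add: partial_def)
  have "((\<lambda>p. - (sin (p $ 1))\<^sup>2) has_derivative (\<lambda>h. - (2 * sin (p $ 1) * cos (p $ 1) * h $ 1))) (at p)"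
    by (auto intro!: derivative_eq_intros bounded_linear.has_derivative[OF bounded_linear_vec_nth])
  then have sin2: "partial k (\<lambda>p. - (sin (p $ 1))\<^sup>2) p
      = - (2 * sin (p $ 1) * cos (p $ 1) * axis k 1 $ 1)" for k
    unfolding partial_def by (rule frechet_derivative_eq_applied)
  have K: "lie_derivative_metric metric \<xi> i j p = 0" for i j
    using assms by (simp add: killing_field_def)
  note K = K[unfolded lie_derivative_metric_def sum_coordinates metric_def]
  note s = sin_pos_chart[OF assms(2)]
  show "d 0 0 = 0" using K[of 0 0] by (simp add: const d_def)
  show "d 1 1 = 0" using K[of 1 1] by (simp add: const d_def)
  show "d 1 0 = d 0 1" using K[of 0 1] by (simp add: const d_def)
  show "d 2 0 = (sin (p $ 1))\<^sup>2 * d 0 2" using K[of 0 2] by (simp add: const d_def)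
  show "d 2 1 = - ((sin (p $ 1))\<^sup>2 * d 1 2)" using K[of 1 2] by (simp add: const d_def)
  \<comment> \<open>The pair \<open>22\<close> is the only one in which the metric coefficient varies.\<close>
  have "sin (p $ 1) * (sin (p $ 1) * d 2 2 + cos (p $ 1) * \<xi> p $ 1) = 0"
  proof -
    have "partial 0 (\<lambda>p. - (sin (p $ 1))\<^sup>2) p = 0" "partial 2 (\<lambda>p. - (sin (p $ 1))\<^sup>2) p = 0"
      "partial 1 (\<lambda>p. - (sin (p $ 1))\<^sup>2) p = - (2 * sin (p $ 1) * cos (p $ 1))"
      unfolding sin2 by (simp_all add: axis_def)
    moreover have "\<xi> p $ 0 * partial 0 (\<lambda>p. - (sin (p $ 1))\<^sup>2) p
        + \<xi> p $ 1 * partial 1 (\<lambda>p. - (sin (p $ 1))\<^sup>2) p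
        + \<xi> p $ 2 * partial 2 (\<lambda>p. - (sin (p $ 1))\<^sup>2) p - 2 * ((sin (p $ 1))\<^sup>2 * d 2 2) = 0"
      using K[of 2 2] by (simp only: d_def) simp
    ultimately show ?thesis by (simp add: power2_eq_square algebra_simps)
  qed
  then show "sin (p $ 1) * d 2 2 = - (cos (p $ 1) * \<xi> p $ 1)" using s by simp
qed

text \<open>
  The components of the potential \<open>V\<close> of a linear equation are of this form.
\<close>

lemma total_derivative_fibre_linear:
  assumes g: "(g has_derivative g') (at p)"
  shows "total_derivative i (\<lambda>z. snd z * g (fst z)) ((p, u), q) = u * g' (axis i 1) + q $ i * g p"
proof -
  have "((\<lambda>z. g (fst z)) has_derivative (\<lambda>h. g' (fst h))) (at (p, u))"
    by (rule has_derivative_compose[OF has_derivative_fst[OF has_derivative_ident]])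
      (use g in simp)
  from has_derivative_mult[OF has_derivative_snd[OF has_derivative_ident] this]
  have "((\<lambda>z. snd z * g (fst z)) has_derivative (\<lambda>h. u * g' (fst h) + snd h * g p)) (at (p, u))"
    by simp
  from frechet_derivative_eq_applied[OF this] show ?thesis
    using linear_0[OF has_derivative_linear[OF g]] by (simp add: total_derivative_def)
qed

text \<open>
  The equations \<open>00\<close> and \<open>11\<close> leave \<open>- \<xi>\<^sup>1 cot x\<close> as the divergence of \<open>\<xi>\<close>, which balances the
  change of the density \<open>sin x\<close>; this settles the term with \<open>F\<close>. Of the quadratic form in \<open>q\<close>,
  the squares cancel by the diagonal equations and the mixed terms by the other three.
\<close>

lemma killing_field_variational_symmetry:
  assumes F: "\<And>u. (F has_real_derivative f u) (at u)" and X: "X \<in> isom"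
  shows "variational_symmetry chart_domain (lagrangian F) X"
proof -
  from X obtain \<xi> where \<xi>: "killing_field \<xi>"
    and X\<xi>: "\<And>p u. p \<in> chart_domain \<Longrightarrow> X (p, u) = (\<xi> p, 0)"
    by (auto simp: isom_def)
  have "first_prolongation X (lagrangian F) ((p, u), q)
      + lagrangian F ((p, u), q) * total_divergence (\<lambda>z. fst (X z)) ((p, u), q) = 0"
    if p: "p \<in> chart_domain" for p u q
  proof -
    define d where "d = (\<lambda>i j. partial i (\<lambda>p. \<xi> p $ j) p)"
    have s: "sin (p $ 1) > 0" by (rule sin_pos_chart[OF p])
    have d22: "d 2 2 = - (cos (p $ 1) * \<xi> p $ 1 / sin (p $ 1))"
      using killing_equations(3)[OF \<xi> p] s by (simp add: d_def field_simps)
    have \<xi>_diff: "\<xi> differentiable (at p)"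
      using smooth_on_has_derivative[OF killing_field_smooth[OF \<xi>] p] by (auto simp: differentiable_def)
    have zero: "partial i (\<lambda>p. 0) p = 0" for i by (simp add: partial_def)
    have d: "partial i (\<lambda>p. \<xi> p $ j) p = d i j" for i j by (simp add: d_def)
    note K = killing_equations[OF \<xi> p, unfolded d]
    show ?thesis
      by (subst first_prolongation_lagrangian[where F = F and f = f and u = u and b = "\<lambda>p. 0",
          OF open_chart_domain p order_refl F \<xi>_diff differentiable_const X\<xi>], assumption,
          unfold sum_coordinates zero d K(1,2,4,5,6) d22)
        (use s in \<open>simp add: lagrangian_def field_simps power2_eq_square\<close>)
  qed
  then show ?thesis
    unfolding variational_symmetry_def using isom_smooth[OF X] by auto
qed

section \<open>Translations by solutions of the linear equation\<close>

text \<open>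
  The potential is \<open>u\<close> times the conserved momentum of \<open>b\<close>: the terms with \<open>q\<close> in its total
  divergence reproduce the prolongation, and the wave equation for \<open>b\<close> turns the remaining one into
  \<open>sin x c u b\<close>.
\<close>

lemma solution_noether_symmetry:
  assumes \<Omega>: "open \<Omega>" "\<Omega> \<subseteq> chart_domain"
    and b: "smooth_on \<Omega> b" "solves_wave_equation (\<lambda>u. c * u) \<Omega> b"
  shows "noether_symmetry \<Omega> (lagrangian (\<lambda>u. c * u\<^sup>2 / 2)) (S_infinity b)"
proof -
  \<comment> \<open>The momenta \<open>\<partial>L/\<partial>q\<^sub>i\<close> along the first jet of \<open>b\<close>.\<close>
  define current :: "real ^ 3 \<Rightarrow> real ^ 3" where "current p = (sin (p $ 1) * partial 0 b p) *\<^sub>R axis 0 1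
      + (- sin (p $ 1) * partial 1 b p) *\<^sub>R axis 1 1
      + (- inverse (sin (p $ 1)) * partial 2 b p) *\<^sub>R axis 2 1" for p
  define V where "V z = snd z *\<^sub>R current (fst z)" for z :: total_space
  have s: "sin (p $ 1) > 0" if "p \<in> \<Omega>" for p
    using that \<Omega>(2) sin_pos_chart by blast
  have \<Omega>_total: "open (\<Omega> \<times> (UNIV :: real set))" using \<Omega>(1) by (simp add: open_Times)
  have smooth_partial: "smooth_on \<Omega> (partial i b)" for i
    using smooth_on_directional_derivative[OF b(1)] by (simp add: partial_def[abs_def])
  have sin: "smooth_on \<Omega> (\<lambda>p. sin (p $ 1))"
    by (intro smooth_on_sin smooth_on_coordinate \<Omega>(1))
  have minus: "smooth_on \<Omega> (\<lambda>p. - h p)" if "smooth_on \<Omega> h" for h :: "real ^ 3 \<Rightarrow> real"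
    by (rule smooth_on_linear_compose[OF \<Omega>(1) that bounded_linear_minus[OF bounded_linear_ident]])
  have smooth_current: "smooth_on \<Omega> current"
    unfolding current_def[abs_def]
    by (intro smooth_on_add smooth_on_scaleR smooth_on_mult smooth_on_const minus smooth_on_inverse
        sin smooth_partial \<Omega>(1)) (use s in force)
  have smooth_V: "smooth_on (\<Omega> \<times> UNIV) V"
    unfolding V_def[abs_def]
    by (intro smooth_on_scaleR \<Omega>_total smooth_on_linear bounded_linear_snd
        smooth_on_compose_linear[OF _ smooth_current bounded_linear_fst]) auto
  have smooth_S: "smooth_on (\<Omega> \<times> UNIV) (S_infinity b)"
  proof (rule smooth_on_fibre_constant[OF \<Omega>(1)])
    show "smooth_on \<Omega> (\<lambda>p. (0 :: real ^ 3, b p))"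
      by (intro smooth_on_Pair smooth_on_const b(1) \<Omega>(1))
  qed (simp add: S_infinity_def)
  have "first_prolongation (S_infinity b) (lagrangian (\<lambda>u. c * u\<^sup>2 / 2)) ((p, u), q)
      + lagrangian (\<lambda>u. c * u\<^sup>2 / 2) ((p, u), q)
          * total_divergence (\<lambda>z. fst (S_infinity b z)) ((p, u), q)
      = total_divergence V ((p, u), q)" if p: "p \<in> \<Omega>" for p u q
  proof -
    have F: "((\<lambda>u. c * u\<^sup>2 / 2) has_real_derivative c * u) (at u)" for u
      by (auto intro!: derivative_eq_intros)
    have b_diff: "b differentiable (at p)"
      using smooth_on_has_derivative[OF b(1) p] by (auto simp: differentiable_def)
    have zero: "partial i (\<lambda>p. 0) p = 0" for i by (simp add: partial_def)
    have lhs: "first_prolongation (S_infinity b) (lagrangian (\<lambda>u. c * u\<^sup>2 / 2)) ((p, u), q)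
      + lagrangian (\<lambda>u. c * u\<^sup>2 / 2) ((p, u), q)
          * total_divergence (\<lambda>z. fst (S_infinity b z)) ((p, u), q)
      = sin (p $ 1) * (c * u) * b p + sin (p $ 1) * q $ 0 * partial 0 b p
        - sin (p $ 1) * q $ 1 * partial 1 b p - q $ 2 * partial 2 b p / sin (p $ 1)"
      by (subst first_prolongation_lagrangian[where f = "\<lambda>u. c * u" and u = u and \<xi> = "\<lambda>p. 0",
            OF \<Omega>(1) p \<Omega>(2) F differentiable_const b_diff])
        (simp_all add: S_infinity_def zero)
    have x: "((\<lambda>p. p $ 1) has_derivative (\<lambda>h. h $ 1)) net" for net :: "(real ^ 3) filter"
      by (rule bounded_linear_imp_has_derivative[OF bounded_linear_vec_nth])
    have D2: "(partial i b has_derivative frechet_derivative (partial i b) (at p)) (at p)" for i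
      by (rule smooth_on_has_derivative[OF smooth_partial p])
    have c0: "((\<lambda>p. current p $ 0) has_derivative
        (\<lambda>h. sin (p $ 1) * frechet_derivative (partial 0 b) (at p) h
          + h $ 1 * cos (p $ 1) * partial 0 b p)) (at p)"
      unfolding current_def by (rule derivative_eq_intros x D2 refl | simp add: axis_def)+
    have c1: "((\<lambda>p. current p $ 1) has_derivative
        (\<lambda>h. - sin (p $ 1) * frechet_derivative (partial 1 b) (at p) h
          - h $ 1 * cos (p $ 1) * partial 1 b p)) (at p)"
      unfolding current_def by (rule derivative_eq_intros x D2 refl | simp add: axis_def)+
    have c2: "((\<lambda>p. current p $ 2) has_derivative
        (\<lambda>h. - inverse (sin (p $ 1)) * frechet_derivative (partial 2 b) (at p) h
          + inverse (sin (p $ 1)) * (h $ 1 * cos (p $ 1)) * inverse (sin (p $ 1)) * partial 2 b p)) (at p)"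
      unfolding current_def
      by (rule derivative_eq_intros x D2 refl | use s[OF p] in \<open>simp add: axis_def\<close>)+
    have wave: "partial 0 (partial 0 b) p = partial 1 (partial 1 b) p
        + cos (p $ 1) / sin (p $ 1) * partial 1 b p
        + 1 / (sin (p $ 1))\<^sup>2 * partial 2 (partial 2 b) p + c * b p"
      using b(2) p by (simp add: solves_wave_equation_def cot_def)
    have V_nth: "(\<lambda>z. V z $ i) = (\<lambda>z. snd z * current (fst z) $ i)" for i
      by (simp add: V_def)
    have comps: "current p $ 0 = sin (p $ 1) * partial 0 b p"
      "current p $ 1 = - sin (p $ 1) * partial 1 b p"
      "current p $ 2 = - inverse (sin (p $ 1)) * partial 2 b p"
      by (simp_all add: current_def axis_def)
    have rhs: "total_divergence V ((p, u), q)
      = u * (sin (p $ 1) * partial 0 (partial 0 b) p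
          - sin (p $ 1) * partial 1 (partial 1 b) p - cos (p $ 1) * partial 1 b p
          - inverse (sin (p $ 1)) * partial 2 (partial 2 b) p)
        + sin (p $ 1) * q $ 0 * partial 0 b p - sin (p $ 1) * q $ 1 * partial 1 b p
        - q $ 2 * partial 2 b p / sin (p $ 1)"
      unfolding total_divergence_def V_nth sum_coordinates total_derivative_fibre_linear[OF c0]
        total_derivative_fibre_linear[OF c1] total_derivative_fibre_linear[OF c2] comps
      by (simp add: partial_def[of _ "partial _ b"] axis_def divide_inverse algebra_simps)
    show ?thesis
      unfolding lhs rhs wave using s[OF p] by (simp add: field_simps power2_eq_square)
  qed
  then show ?thesis
    unfolding noether_symmetry_def using smooth_S smooth_V by auto
qed

theorem theorem2:
  fixes f F :: "real \<Rightarrow> real"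
  assumes "smooth_on UNIV f"
    and "\<forall>u. (F has_real_derivative f u) (at u)"
  shows "(lie_algebra_on chart_domain isom \<and>
            (\<forall>X\<in>isom. variational_symmetry chart_domain (lagrangian F) X)) \<and>
         (\<forall>c \<Omega> b. f = (\<lambda>u. c * u) \<longrightarrow> F = (\<lambda>u. c * u\<^sup>2 / 2) \<longrightarrow>
            open \<Omega> \<longrightarrow> \<Omega> \<subseteq> chart_domain \<longrightarrow>
            smooth_on \<Omega> b \<longrightarrow> solves_wave_equation f \<Omega> b \<longrightarrow>
            noether_symmetry \<Omega> (lagrangian F) (S_infinity b))"
  using assms(2) isom_lie_algebra killing_field_variational_symmetry[of F f]
    solution_noether_symmetry by blast

end
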